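(* Let $p:\mathbb Z^2\to\hat{\mathbb C}$ be a P-net, and consider the square lattice with face weights $(a_{i,j})_{(i,j)\in\mathbb Z^2}$ given by $a_{i,j}=p_{i,[i+j]_2}$. Then, for all $i\in\mathbb Z$ and $k\ge 1$, $$p_{i,k}=Y\bigl(A_{k-1}[p_{i,[k]_2}],a\bigr),$$ where $A_{k-1}[p_{i,[k]_2}]$ denotes the Aztec diamond $A_{k-1}(i,j)$ of size $k-1$ centered at any face $(i,j)$ (with first coordinate $i$) such that $[i+j]_2=[k]_2$, so that its central face carries the weight $p_{i,[k]_2}$; since $a$ is invariant under translation by $(0,2)$, the choice of $j$ does not matter.
   Context: $\hat{\mathbb C}=\mathbb C\cup\{\infty\}$ is identified with $\mathbb{CP}^1$, with the usual arithmetic; $[n]_q\in\{0,\dots,q-1\}$ is the residue of $n$ modulo $q$. P-net: a map $p:\mathbb Z^2\to\hat{\mathbb C}$ such that for all $(i,j)$, $\frac{1}{p_{i+1,j}-p_{i,j}}-\frac{1}{p_{i,j+1}-p_{i,j}}+\frac{1}{p_{i-1,j}-p_{i,j}}-\frac{1}{p_{i,j-1}-p_{i,j}}=0$. Ratio function of oriented dimers. Consider the square lattice whose faces are the unit squares centered at the points of $\mathbb Z^2$, face $(i,j)$ carrying the weight $a_{i,j}$. For $k\ge1$, the Aztec diamond $A_k(i,j)$ of size $k$ centered at $(i,j)$ is the subgraph formed by the vertices and edges of its internal faces, which are the faces $(i',j')$ with $|i'-i|+|j'-j|<k$; its open faces are the $(i',j')$ with $|i'-i|+|j'-j|=k$;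 $F$ is the set of all internal and open faces. The graph is bipartite (black and white vertices). A Kasteleyn orientation is a skew-symmetric function $\varphi$ from directed edges to $\{-1,1\}$ such that for every internal face $f$, $\prod_{wb\in\partial f}\varphi_{(w,b)}=-1$ (product over the four boundary edges, each directed from white to black). An oriented dimer configuration $\vec{M}$ is a set of directed edges whose undirected version is a perfect matching (each matched edge carrying exactly one direction). Its weight is $\prod_{\vec e\in\vec M}\varphi_{\vec e}\,a_{f(\vec e)}$, where $f(\vec e)\in F$ is the face to the right of $\vec e$. $Z(A,a,\varphi)$ is the sum of the weights of all oriented dimer configurations of $A$, and $$Y(A,a)=\Bigl(\prod_{f\in F}a_f\Bigr)\frac{Z(A,a^{-1},\varphi)}{Z(A,a,\varphi)},$$ where $a^{-1}$ denotes the inverse face weights; this does not depend on $\varphi$. For size $0$: $A_0(i,j)$ has no internal face and the single open face $(i,j)$, and $Y(A_0(i,j),a)=a_{i,j}$. $Y$ is regarded as a rational function of the face weights. Standing assumption: the data are generic, so that all expressions are well defined.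
   Formalization: Where p_{i,j}=∞ the P-net equation, void under the usual arithmetic (which would make the claim false), is read in its Möbius-invariant form: the four neighbours are finite and p_{i+1,j}−p_{i,j+1}+p_{i−1,j}−p_{i,j−1}=0. *)

theory Defs
  imports "HOL-Analysis.Analysis"
begin

section \<open>The Riemann sphere and P-nets\<close>

text \<open>The point at infinity is \<^term>\<open>None\<close>.\<close>

type_synonym sphere = "complex option"

definition sphere_top :: "sphere topology" where
  "sphere_top = Alexandroff_compactification euclidean"

text \<open>
  \<open>recip_diff c x\<close> is \<open>1 / (x - c)\<close>, an affine coordinate of \<open>x\<close> with pole at \<open>c\<close>, for \<open>x \<noteq> c\<close>.
  For \<open>c = \<infinity>\<close> the literal value would be 0 whatever \<open>x\<close> is. There we use the coordinate \<open>x\<close>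
  itself: as \<open>c\<close> tends to infinity, \<open>1 / (x - c) = - 1 / c - x / c\<^sup>2 + O(1 / c\<^sup>3)\<close>, so that the P-net
  sum, whose coefficients \<open>1, -1, 1, -1\<close> add up to 0, has leading coefficient (up to sign) the
  alternating sum of the \<open>x\<close>. This is the only reading of the P-net equation at infinity that
  is invariant under Moebius transformations. The value for \<open>x = c\<close> is irrelevant.
\<close>

fun recip_diff :: "sphere \<Rightarrow> sphere \<Rightarrow> complex" where
  "recip_diff (Some c) (Some x) = 1 / (x - c)"
| "recip_diff (Some c) None = 0"
| "recip_diff None (Some x) = x"
| "recip_diff None None = 0"

text \<open>
  The inequalities say that the four terms are defined: a single term \<open>1 / 0 = \<infinity>\<close> gives the
  sum \<open>\<infinity>\<close>, which is not 0, and with two or more of them the sum is undefined.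
\<close>

definition P_net :: "(int \<times> int \<Rightarrow> sphere) \<Rightarrow> bool" where
  "P_net p \<longleftrightarrow> (\<forall>i j.
     p (i + 1, j) \<noteq> p (i, j) \<and> p (i, j + 1) \<noteq> p (i, j) \<and>
     p (i - 1, j) \<noteq> p (i, j) \<and> p (i, j - 1) \<noteq> p (i, j) \<and>
     recip_diff (p (i, j)) (p (i + 1, j)) - recip_diff (p (i, j)) (p (i, j + 1))
       + recip_diff (p (i, j)) (p (i - 1, j)) - recip_diff (p (i, j)) (p (i, j - 1)) = 0)"

definition P_net_weights :: "(int \<times> int \<Rightarrow> sphere) \<Rightarrow> (int \<times> int \<Rightarrow> sphere)" where
  "P_net_weights p = (\<lambda>(i, j). p (i, (i + j) mod 2))"


section \<open>Aztec diamonds\<close>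

text \<open>
  A face is named by its centre. The vertex named \<open>(x, y)\<close> is the point \<open>(x - 1/2, y - 1/2)\<close>,
  i.e. the lower left corner of the face \<open>(x, y)\<close>.
\<close>

type_synonym face = "int \<times> int"
type_synonym vertex = "int \<times> int"
type_synonym arc = "vertex \<times> vertex"

fun corners :: "face \<Rightarrow> vertex set" where
  "corners (x, y) = {(x, y), (x + 1, y), (x, y + 1), (x + 1, y + 1)}"

fun adjacent :: "vertex \<Rightarrow> vertex \<Rightarrow> bool" where
  "adjacent (x, y) (x', y') \<longleftrightarrow> \<bar>x' - x\<bar> + \<bar>y' - y\<bar> = 1"

fun white :: "vertex \<Rightarrow> bool" where
  "white (x, y) \<longleftrightarrow> even (x + y)"

fun internal_faces :: "nat \<Rightarrow> face \<Rightarrow> face set" where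
  "internal_faces k (i, j) = {(i', j'). \<bar>i' - i\<bar> + \<bar>j' - j\<bar> < int k}"

fun open_faces :: "nat \<Rightarrow> face \<Rightarrow> face set" where
  "open_faces k (i, j) = {(i', j'). \<bar>i' - i\<bar> + \<bar>j' - j\<bar> = int k}"

definition all_faces :: "nat \<Rightarrow> face \<Rightarrow> face set" where
  "all_faces k c = internal_faces k c \<union> open_faces k c"

definition face_arcs :: "face \<Rightarrow> arc set" where
  "face_arcs f = {(u, v). u \<in> corners f \<and> v \<in> corners f \<and> adjacent u v}"

definition aztec_vertices :: "nat \<Rightarrow> face \<Rightarrow> vertex set" where
  "aztec_vertices k c = (\<Union>f \<in> internal_faces k c. corners f)"

text \<open>Every edge occurs with both of its directions.\<close>

definition aztec_arcs :: "nat \<Rightarrow> face \<Rightarrow> arc set" where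
  "aztec_arcs k c = (\<Union>f \<in> internal_faces k c. face_arcs f)"

text \<open>The cases are: upwards, downwards, to the right, to the left.\<close>

fun right_face :: "arc \<Rightarrow> face" where
  "right_face ((x, y), (x', y')) =
     (if y' = y + 1 then (x, y)
      else if y' = y - 1 then (x - 1, y')
      else if x' = x + 1 then (x, y - 1)
      else (x', y))"


section \<open>The ratio function of oriented dimers\<close>

definition kasteleyn :: "nat \<Rightarrow> face \<Rightarrow> (arc \<Rightarrow> int) \<Rightarrow> bool" where
  "kasteleyn k c \<phi> \<longleftrightarrow>
     (\<forall>(u, v) \<in> aztec_arcs k c. \<phi> (u, v) \<in> {-1, 1} \<and> \<phi> (v, u) = - \<phi> (u, v)) \<and>
     (\<forall>f \<in> internal_faces k c. (\<Prod>e \<in> {e \<in> face_arcs f. white (fst e)}. \<phi> e) = -1)"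

definition oriented_dimers :: "nat \<Rightarrow> face \<Rightarrow> arc set set" where
  "oriented_dimers k c =
     {M. M \<subseteq> aztec_arcs k c \<and> (\<forall>v \<in> aztec_vertices k c. \<exists>!e. e \<in> M \<and> (v = fst e \<or> v = snd e))}"

definition dimer_Z :: "nat \<Rightarrow> face \<Rightarrow> (face \<Rightarrow> complex) \<Rightarrow> (arc \<Rightarrow> int) \<Rightarrow> complex" where
  "dimer_Z k c a \<phi> = (\<Sum>M \<in> oriented_dimers k c. \<Prod>e \<in> M. of_int (\<phi> e) * a (right_face e))"

definition ratio_Y :: "nat \<Rightarrow> face \<Rightarrow> (face \<Rightarrow> complex) \<Rightarrow> (arc \<Rightarrow> int) \<Rightarrow> complex" where
  "ratio_Y k c a \<phi> =
     (\<Prod>f \<in> all_faces k c. a f) * (dimer_Z k c (\<lambda>f. inverse (a f)) \<phi> / dimer_Z k c a \<phi>)"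

definition regular_weights :: "nat \<Rightarrow> face \<Rightarrow> (arc \<Rightarrow> int) \<Rightarrow> (face \<Rightarrow> complex) set" where
  "regular_weights k c \<phi> = {b. (\<forall>f \<in> all_faces k c. b f \<noteq> 0) \<and> dimer_Z k c b \<phi> \<noteq> 0}"

text \<open>
  \<open>Y\<close> as a rational function of independent face weights in the sphere: its value at \<open>a\<close> is the
  limit of the formula at complex weights \<open>b\<close> that tend to \<open>a\<close> on every face while the formula
  makes sense at \<open>b\<close>. For a rational function this limit exists exactly at the points where the
  reduced fraction is not \<open>0 / 0\<close>. The neighbourhoods of \<open>a\<close> are not punctured; at weights where
  the formula makes sense the value is that of the formula (\<open>Y_value_regular\<close> below).
\<close>

definition weights_near :: "face set \<Rightarrow> (face \<Rightarrow> sphere) \<Rightarrow> (face \<Rightarrow> complex) filter" where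
  "weights_near F a = (INF f \<in> F. filtercomap (\<lambda>b. Some (b f)) (nhdsin sphere_top (a f)))"

definition Y_has_value ::
    "nat \<Rightarrow> face \<Rightarrow> (arc \<Rightarrow> int) \<Rightarrow> (face \<Rightarrow> sphere) \<Rightarrow> sphere \<Rightarrow> bool" where
  "Y_has_value k c \<phi> a y \<longleftrightarrow>
     limitin sphere_top (\<lambda>b. Some (ratio_Y k c b \<phi>)) y
       (inf (weights_near (all_faces k c) a) (principal (regular_weights k c \<phi>)))"

definition Y_defined :: "nat \<Rightarrow> face \<Rightarrow> (arc \<Rightarrow> int) \<Rightarrow> (face \<Rightarrow> sphere) \<Rightarrow> bool" where
  "Y_defined k c \<phi> a \<longleftrightarrow> (\<exists>y. Y_has_value k c \<phi> a y)"

definition Y_value :: "nat \<Rightarrow> face \<Rightarrow> (arc \<Rightarrow> int) \<Rightarrow> (face \<Rightarrow> sphere) \<Rightarrow> sphere" where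
  "Y_value k c \<phi> a = (THE y. Y_has_value k c \<phi> a y)"


subsection \<open>Agreement with the formula at regular weights\<close>

lemma Hausdorff_sphere_top: "Hausdorff_space sphere_top"
  unfolding sphere_top_def
  by (simp add: Hausdorff_space_Alexandroff_compactification locally_compact_space_euclidean)

lemma right_face_in_all_faces:
  assumes "e \<in> aztec_arcs k c"
  shows "right_face e \<in> all_faces k c"
proof -
  obtain i j x y x' y' where [simp]: "c = (i, j)" "e = ((x, y), (x', y'))"
    by (metis surj_pair)
  obtain s t where st: "\<bar>s - i\<bar> + \<bar>t - j\<bar> < int k" "(x, y) \<in> corners (s, t)"
      "(x', y') \<in> corners (s, t)" "\<bar>x' - x\<bar> + \<bar>y' - y\<bar> = 1"
    using assms by (auto simp: aztec_arcs_def face_arcs_def)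
  then show ?thesis
    by (auto simp: all_faces_def split: if_splits)
qed

lemma tendsto_weights_near:
  assumes "f \<in> F" "a f = Some z"
  shows "((\<lambda>b. b f) \<longlongrightarrow> z) (weights_near F a)"
proof (rule topological_tendstoI)
  fix S :: "complex set"
  assume S: "open S" "z \<in> S"
  have "eventually (\<lambda>w. w \<in> Some ` S) (nhdsin sphere_top (a f))"
    using S assms(2) by (auto simp: eventually_nhdsin sphere_top_def intro!: exI[of _ "Some ` S"])
  then have "eventually (\<lambda>b. Some (b f) \<in> Some ` S)
      (filtercomap (\<lambda>b. Some (b f)) (nhdsin sphere_top (a f)))"
    by (rule eventually_filtercomapI)
  then have "eventually (\<lambda>b. Some (b f) \<in> Some ` S) (weights_near F a)"
    unfolding weights_near_def using assms(1) by (rule eventually_INF1[rotated])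
  then show "eventually (\<lambda>b. b f \<in> S) (weights_near F a)"
    by (rule eventually_mono) auto
qed

lemma tendsto_dimer_Z:
  assumes "\<And>f. f \<in> all_faces k c \<Longrightarrow> ((\<lambda>b. g b f) \<longlongrightarrow> \<alpha> f) G"
  shows "((\<lambda>b. dimer_Z k c (g b) \<phi>) \<longlongrightarrow> dimer_Z k c \<alpha> \<phi>) G"
  unfolding dimer_Z_def
  by (intro tendsto_sum tendsto_prod tendsto_mult tendsto_const assms right_face_in_all_faces)
    (auto simp: oriented_dimers_def)

lemma weights_near_regular_nontrivial:
  assumes "\<And>f. f \<in> all_faces k c \<Longrightarrow> a f = Some (\<alpha> f)" and "\<alpha> \<in> regular_weights k c \<phi>"
  shows "inf (weights_near (all_faces k c) a) (principal (regular_weights k c \<phi>)) \<noteq> bot"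
proof -
  have "principal {\<alpha>} \<le> weights_near (all_faces k c) a"
    unfolding weights_near_def
  proof (rule INF_greatest)
    fix f assume f: "f \<in> all_faces k c"
    show "principal {\<alpha>} \<le> filtercomap (\<lambda>b. Some (b f)) (nhdsin sphere_top (a f))"
      using assms(1)[OF f]
      by (auto simp: le_filter_def eventually_filtercomap eventually_principal
          eventually_nhdsin sphere_top_def)
  qed
  moreover have "principal {\<alpha>} \<le> principal (regular_weights k c \<phi>)"
    using assms(2) by simp
  ultimately have "principal {\<alpha>} \<le>
      inf (weights_near (all_faces k c) a) (principal (regular_weights k c \<phi>))"
    by simp
  then show ?thesis
    by (metis bot.extremum_uniqueI insert_not_empty principal_eq_bot_iff)
qed

lemma Y_value_regular:
  assumes a: "\<And>f. f \<in> all_faces k c \<Longrightarrow> a f = Some (\<alpha> f)" and "\<alpha> \<in> regular_weights k c \<phi>"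
  shows "Y_defined k c \<phi> a" and "Y_value k c \<phi> a = Some (ratio_Y k c \<alpha> \<phi>)"
proof -
  let ?G = "inf (weights_near (all_faces k c) a) (principal (regular_weights k c \<phi>))"
  have nz: "dimer_Z k c \<alpha> \<phi> \<noteq> 0" "\<And>f. f \<in> all_faces k c \<Longrightarrow> \<alpha> f \<noteq> 0"
    using assms(2) by (auto simp: regular_weights_def)
  have lim: "((\<lambda>b. b f) \<longlongrightarrow> \<alpha> f) ?G" if "f \<in> all_faces k c" for f
    using tendsto_weights_near[of f "all_faces k c" a, OF that a[OF that]]
    by (rule tendsto_mono[rotated]) simp
  have "((\<lambda>b. ratio_Y k c b \<phi>) \<longlongrightarrow> ratio_Y k c \<alpha> \<phi>) ?G"
    unfolding ratio_Y_def
    by (intro tendsto_mult tendsto_divide tendsto_prod tendsto_dimer_Z tendsto_inverse lim nz)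
  then have val: "Y_has_value k c \<phi> a (Some (ratio_Y k c \<alpha> \<phi>))"
    unfolding Y_has_value_def sphere_top_def
    using continuous_map_limit[OF continuous_map_Some, of euclidean] by (simp add: o_def)
  then show "Y_defined k c \<phi> a"
    by (auto simp: Y_defined_def)
  show "Y_value k c \<phi> a = Some (ratio_Y k c \<alpha> \<phi>)"
    unfolding Y_value_def
    using val limitin_Hausdorff_unique[OF _ _ _ Hausdorff_sphere_top]
      weights_near_regular_nontrivial[OF assms]
    by (intro the_equality) (auto simp: Y_has_value_def)
qed

end

theory Submission
  imports Defs
begin

text \<open>
  Write \<open>Z\<close> for the oriented dimer partition function. One step of domino shuffling expresses
  \<open>Z\<close> of the Aztec diamond of size \<open>k + 1\<close> with face weights \<open>a\<close> through \<open>Z\<close> of the one of size \<open>k\<close>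
  with weights \<open>a'\<close>, where \<open>a'\<close> replaces the weight \<open>d\<close> of every second face, with neighbours
  \<open>n, e, s, w\<close>, by the solution \<open>u\<close> of the dSKP equation (the pairs \<open>{d, u}\<close>, \<open>{n, s}\<close>, \<open>{e, w}\<close> are in
  involution). The factor is a product over faces and vertices. The dSKP equation is invariant under
  inversion, so the same holds for the weights \<open>1 / a\<close>, and the prefactors combine
  in such a way that \<open>Y\<close> is invariant under the step. Iterating down to size 0, \<open>Y\<close> is the value at the
  apex of the dSKP solution with initial data \<open>a\<close>.

  A P-net \<open>p\<close> gives the solution \<open>p (i, k)\<close> of the dSKP equation with \<open>n = s\<close>, which is degenerate for the
  shuffling step. Near its initial data there are nondegenerate complex data: in
  homogeneous coordinates solutions are polynomial in the data, and the data \<open>i + 1 / 2\<close> are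
  nondegenerate. At a P-net the homogeneous dSKP step does not vanish, so the perturbed solutions
  converge to \<open>p\<close>, and \<open>p (i, k)\<close> is the limit that defines the value of \<open>Y\<close>.
\<close>

section \<open>Dimers as assignments of vertices to cells\<close>

definition matchings :: "'v set \<Rightarrow> ('v \<times> 'v) set \<Rightarrow> ('v \<times> 'v) set set" where
  "matchings V E = {M. M \<subseteq> E \<and> (\<forall>v \<in> V. \<exists>!e. e \<in> M \<and> (v = fst e \<or> v = snd e))}"

definition inner_arcs :: "'v set \<Rightarrow> ('v \<times> 'v) set \<Rightarrow> ('v \<times> 'v) set" where
  "inner_arcs V E = {e \<in> E. fst e \<in> V \<and> snd e \<in> V}"

text \<open>The arcs are restricted to \<open>V\<close> inside the sum, so that one arc set
  \<open>E\<close> can stay fixed while \<open>V\<close> varies.\<close>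

definition matching_sum :: "('v \<times> 'v) set \<Rightarrow> ('v \<times> 'v \<Rightarrow> complex) \<Rightarrow> 'v set \<Rightarrow> complex" where
  "matching_sum E w V = (\<Sum>M \<in> matchings V (inner_arcs V E). \<Prod>e \<in> M. w e)"

definition verts :: "('v \<times> 'v) set \<Rightarrow> 'v set" where
  "verts M = fst ` M \<union> snd ` M"

text \<open>\<open>S f\<close> stands for the set of vertices that a matching covers by arcs of the
  cell \<open>f\<close>. Extensionality makes an assignment determined by its values on
  \<open>I\<close>.\<close>

definition assignments :: "'f set \<Rightarrow> ('f \<Rightarrow> 'v set) \<Rightarrow> 'v set \<Rightarrow> ('f \<Rightarrow> 'v set) set" where
  "assignments I K V =
     {S \<in> I \<rightarrow>\<^sub>E UNIV. (\<forall>f \<in> I. S f \<subseteq> K f \<inter> V) \<and> (\<forall>v \<in> V. \<exists>!f. f \<in> I \<and> v \<in> S f)}"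

lemma verts_matching:
  assumes M: "M \<in> matchings V (inner_arcs V E)"
  shows "verts M = V"
proof
  show "V \<subseteq> verts M"
  proof
    fix v assume "v \<in> V"
    then have "\<exists>!e. e \<in> M \<and> (v = fst e \<or> v = snd e)"
      using M by (simp add: matchings_def)
    then show "v \<in> verts M" by (auto simp: verts_def)
  qed
  show "verts M \<subseteq> V" using M by (auto simp: verts_def matchings_def inner_arcs_def)
qed

lemma finite_matchings: "finite E \<Longrightarrow> finite (matchings V (inner_arcs V E))"
  by (rule finite_subset[of _ "Pow E"]) (auto simp: matchings_def inner_arcs_def)

lemma finite_assignments:
  assumes "finite I" "finite V"
  shows "finite (assignments I K V)"
proof (rule finite_subset)
  show "assignments I K V \<subseteq> (\<Pi>\<^sub>E f \<in> I. Pow V)"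
    unfolding assignments_def by (rule subsetI, drule CollectD) (simp add: PiE_iff)
  show "finite (\<Pi>\<^sub>E f \<in> I. Pow V)" using assms by (intro finite_PiE) auto
qed

text \<open>Sort the matchings by the vertices that each cell covers. The cells have no arc in
  common, so a matching amounts to an assignment together with a matching of \<open>S f\<close>
  inside each cell, and the weights multiply.\<close>

lemma matching_sum_assignments:
  fixes R :: "'f \<Rightarrow> ('v \<times> 'v) set"
  assumes fin: "finite I" "finite V" "\<And>f. f \<in> I \<Longrightarrow> finite (R f)"
    and disj: "\<And>f g. f \<in> I \<Longrightarrow> g \<in> I \<Longrightarrow> f \<noteq> g \<Longrightarrow> R f \<inter> R g = {}"
    and ends: "\<And>f e. e \<in> R f \<Longrightarrow> fst e \<in> K f \<and> snd e \<in> K f"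
  shows "matching_sum (\<Union>f \<in> I. R f) w V =
    (\<Sum>S \<in> assignments I K V. \<Prod>f \<in> I. matching_sum (R f) w (S f))"
proof -
  define L where "L S f = matchings (S f) (inner_arcs (S f) (R f))" for S f
  define E where "E = inner_arcs V (\<Union>f \<in> I. R f)"
  let ?A = "assignments I K V"
  have "(\<Sum>S \<in> ?A. \<Prod>f \<in> I. matching_sum (R f) w (S f)) =
      (\<Sum>S \<in> ?A. \<Sum>m \<in> PiE I (L S). \<Prod>f \<in> I. \<Prod>e \<in> m f. w e)"
    unfolding matching_sum_def L_def
    by (intro sum.cong refl prod_sum_PiE) (auto intro: fin finite_matchings)
  also have "\<dots> = (\<Sum>(S, m) \<in> Sigma ?A (\<lambda>S. PiE I (L S)). \<Prod>f \<in> I. \<Prod>e \<in> m f. w e)"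
    by (rule sum.Sigma)
      (auto intro!: finite_assignments finite_PiE fin finite_matchings simp: L_def)
  also have "\<dots> = (\<Sum>M \<in> matchings V E. \<Prod>e \<in> M. w e)"
  proof (rule sum.reindex_bij_witness[symmetric,
        where j = "\<lambda>M. (\<lambda>f \<in> I. verts (M \<inter> R f), \<lambda>f \<in> I. M \<inter> R f)"
          and i = "\<lambda>(S, m). \<Union>f \<in> I. m f"])
    fix M assume M: "M \<in> matchings V E"
    have sub: "M \<subseteq> (\<Union>f \<in> I. R f)" "M \<subseteq> E"
      using M by (auto simp: matchings_def E_def inner_arcs_def)
    \<comment> \<open>Arcs of \<open>M\<close> with a common vertex are equal; as the cells share no
      arc, the cell that covers a vertex is unique.\<close>
    have uniq: "e = e'" if "e \<in> M" "e' \<in> M" "v \<in> verts {e}" "v \<in> verts {e'}" for e e' v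
    proof -
      have "v \<in> V" using that sub by (auto simp: E_def inner_arcs_def verts_def)
      then have "\<exists>!e. e \<in> M \<and> (v = fst e \<or> v = snd e)"
        using M by (auto simp: matchings_def)
      then show ?thesis using that by (auto simp: verts_def)
    qed
    have verts: "v \<in> verts N \<longleftrightarrow> (\<exists>e \<in> N. v \<in> verts {e})" for v and N :: "('v \<times> 'v) set"
      by (auto simp: verts_def)
    show un: "(case (\<lambda>f \<in> I. verts (M \<inter> R f), \<lambda>f \<in> I. M \<inter> R f) of (S, m) \<Rightarrow> \<Union>f \<in> I. m f) = M"
      using sub by auto
    have "(\<lambda>f \<in> I. verts (M \<inter> R f)) \<in> ?A"
      unfolding assignments_def
    proof (intro CollectI conjI ballI)
      fix f assume "f \<in> I"
      then show "(\<lambda>f \<in> I. verts (M \<inter> R f)) f \<subseteq> K f \<inter> V"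
        using sub ends by (auto simp: verts_def E_def inner_arcs_def)
    next
      fix v assume "v \<in> V"
      then have "\<exists>!e. e \<in> M \<and> (v = fst e \<or> v = snd e)"
        using M by (simp add: matchings_def)
      then obtain e where e: "e \<in> M" "v \<in> verts {e}"
        by (auto simp: verts_def)
      then obtain f where f: "f \<in> I" "e \<in> R f" using sub by auto
      show "\<exists>!f. f \<in> I \<and> v \<in> (\<lambda>f \<in> I. verts (M \<inter> R f)) f"
      proof (rule ex1I[of _ f])
        show "f \<in> I \<and> v \<in> (\<lambda>f \<in> I. verts (M \<inter> R f)) f"
          using e f by (auto simp: verts_def)
        fix g assume g: "g \<in> I \<and> v \<in> (\<lambda>f \<in> I. verts (M \<inter> R f)) g"
        then obtain e' where "e' \<in> M" "e' \<in> R g" "v \<in> verts {e'}"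
          using verts[of v "M \<inter> R g"] by auto
        then show "g = f" using uniq[of e e' v] e f g disj[of f g] by auto
      qed
    qed auto
    moreover have "(\<lambda>f \<in> I. M \<inter> R f) \<in> PiE I (L (\<lambda>f \<in> I. verts (M \<inter> R f)))"
    proof (rule PiE_I)
      fix f assume f: "f \<in> I"
      have "\<exists>!e. e \<in> M \<inter> R f \<and> (v = fst e \<or> v = snd e)" if v: "v \<in> verts (M \<inter> R f)" for v
      proof -
        obtain e where e: "e \<in> M \<inter> R f" "v \<in> verts {e}" using v verts[of v "M \<inter> R f"] by auto
        show ?thesis
          by (rule ex1I[of _ e]) (use e uniq[of e _ v] in \<open>auto simp: verts_def\<close>)
      qed
      then show "(\<lambda>f \<in> I. M \<inter> R f) f \<in> L (\<lambda>f \<in> I. verts (M \<inter> R f)) f"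
        using f unfolding L_def matchings_def inner_arcs_def by (auto simp: verts_def)
    qed auto
    ultimately show "(\<lambda>f \<in> I. verts (M \<inter> R f), \<lambda>f \<in> I. M \<inter> R f) \<in> Sigma ?A (\<lambda>S. PiE I (L S))"
      by simp
    have "(\<Prod>e \<in> (\<Union>f \<in> I. M \<inter> R f). w e) = (\<Prod>f \<in> I. \<Prod>e \<in> M \<inter> R f. w e)"
      by (rule prod.UNION_disjoint) (use fin disj in auto)
    moreover have "(\<Union>f \<in> I. M \<inter> R f) = M" using sub by auto
    ultimately show "(case (\<lambda>f \<in> I. verts (M \<inter> R f), \<lambda>f \<in> I. M \<inter> R f) of
        (S, m) \<Rightarrow> \<Prod>f \<in> I. \<Prod>e \<in> m f. w e) = (\<Prod>e \<in> M. w e)"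
      by simp
  next
    fix Sm assume "Sm \<in> Sigma ?A (\<lambda>S. PiE I (L S))"
    then obtain S m where [simp]: "Sm = (S, m)" and S: "S \<in> ?A" and m: "m \<in> PiE I (L S)"
      by auto
    have mL: "m f \<in> matchings (S f) (inner_arcs (S f) (R f))" if "f \<in> I" for f
      using m that by (auto simp: L_def PiE_def Pi_def)
    then have mR: "m f \<subseteq> R f" if "f \<in> I" for f
      using that by (auto simp: matchings_def inner_arcs_def)
    have mS: "verts (m f) = S f" if "f \<in> I" for f
      using verts_matching[OF mL[OF that]] .
    have inter: "(\<Union>g \<in> I. m g) \<inter> R f = m f" if "f \<in> I" for f
      using mR disj that by (fastforce)
    show "(\<lambda>M. (\<lambda>f \<in> I. verts (M \<inter> R f), \<lambda>f \<in> I. M \<inter> R f)) (case Sm of (S, m) \<Rightarrow> \<Union>f \<in> I. m f) = Sm"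
    proof -
      have "restrict S I = S" "restrict m I = m"
        using S m by (simp_all add: assignments_def PiE_iff extensional_restrict)
      moreover have "(\<lambda>f \<in> I. verts ((\<Union>g \<in> I. m g) \<inter> R f)) = restrict S I"
          "(\<lambda>f \<in> I. (\<Union>g \<in> I. m g) \<inter> R f) = restrict m I"
        by (rule restrict_ext; simp only: inter mS)+
      ultimately show ?thesis by simp
    qed
    have "m f \<subseteq> E" if "f \<in> I" for f
    proof
      fix e assume e: "e \<in> m f"
      then have "fst e \<in> S f" "snd e \<in> S f" using mS[OF that] by (auto simp: verts_def)
      moreover have "S f \<subseteq> V" using S that by (simp add: assignments_def)
      ultimately show "e \<in> E" using e mR[OF that] that by (auto simp: E_def inner_arcs_def)
    qed
    then have "(\<Union>f \<in> I. m f) \<subseteq> E" by blast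
    moreover have "\<exists>!e. e \<in> (\<Union>f \<in> I. m f) \<and> (v = fst e \<or> v = snd e)" if "v \<in> V" for v
    proof -
      obtain f where f: "f \<in> I" "v \<in> S f" "\<And>g. g \<in> I \<Longrightarrow> v \<in> S g \<Longrightarrow> g = f"
        using S \<open>v \<in> V\<close> unfolding assignments_def by blast
      obtain e where e: "e \<in> m f" "v = fst e \<or> v = snd e"
          "\<And>e'. e' \<in> m f \<Longrightarrow> v = fst e' \<or> v = snd e' \<Longrightarrow> e' = e"
        using mL[OF f(1)] f(2) unfolding matchings_def by blast
      show ?thesis
      proof (rule ex1I[of _ e])
        fix e' assume e': "e' \<in> (\<Union>f \<in> I. m f) \<and> (v = fst e' \<or> v = snd e')"
        then obtain g where g: "g \<in> I" "e' \<in> m g" by auto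
        then have "v \<in> S g" using e' mS[OF g(1)] by (auto simp: verts_def)
        then have "g = f" using f(3) g by blast
        then show "e' = e" using g e' e(3) by blast
      next
        show "e \<in> (\<Union>f \<in> I. m f) \<and> (v = fst e \<or> v = snd e)"
          using e(1,2) f(1) by blast
      qed
    qed
    ultimately show "(case Sm of (S, m) \<Rightarrow> \<Union>f \<in> I. m f) \<in> matchings V E"
      by (auto simp: matchings_def)
  qed
  finally show ?thesis by (simp add: matching_sum_def E_def)
qed

lemma prod_partition:
  assumes S: "S \<in> assignments I K V" and "finite I" "finite V"
  shows "(\<Prod>f \<in> I. \<Prod>v \<in> S f. g v) = (\<Prod>v \<in> V. g v)"
proof -
  have "(\<Union>f \<in> I. S f) = V" using S unfolding assignments_def by blast
  moreover have "(\<Prod>v \<in> (\<Union>f \<in> I. S f). g v) = (\<Prod>f \<in> I. \<Prod>v \<in> S f. g v)"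
  proof (rule prod.UNION_disjoint)
    show "\<forall>f \<in> I. finite (S f)" using S assms unfolding assignments_def by (auto intro: finite_subset[OF _ \<open>finite V\<close>])
    show "\<forall>f \<in> I. \<forall>h \<in> I. f \<noteq> h \<longrightarrow> S f \<inter> S h = {}"
      using S unfolding assignments_def by blast
  qed fact
  ultimately show ?thesis by simp
qed

text \<open>
  A vertex of two cells is assigned to one of them, and complementing the assignment in every cell
  moves it to the other; the vertices of a single cell drop out.
\<close>

lemma matching_sum_complement:
  fixes R :: "'f \<Rightarrow> ('v \<times> 'v) set"
  assumes fin: "finite I" "\<And>f. f \<in> I \<Longrightarrow> finite (R f)" "\<And>f. f \<in> I \<Longrightarrow> finite (K f)"
    and disj: "\<And>f g. f \<in> I \<Longrightarrow> g \<in> I \<Longrightarrow> f \<noteq> g \<Longrightarrow> R f \<inter> R g = {}"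
    and ends: "\<And>f e. e \<in> R f \<Longrightarrow> fst e \<in> K f \<and> snd e \<in> K f"
    and U: "U = (\<Union>f \<in> I. K f)"
    and V: "V = {v. \<exists>f \<in> I. \<exists>g \<in> I. f \<noteq> g \<and> v \<in> K f \<and> v \<in> K g}"
    and two: "\<And>f g h v. f \<in> I \<Longrightarrow> g \<in> I \<Longrightarrow> h \<in> I \<Longrightarrow> v \<in> K f \<Longrightarrow> v \<in> K g \<Longrightarrow> v \<in> K h \<Longrightarrow>
       f = g \<or> f = h \<or> g = h"
    and loc: "\<And>f S. f \<in> I \<Longrightarrow> S \<subseteq> K f \<Longrightarrow> matching_sum (R f) w S =
       \<Delta> f * (\<Prod>v \<in> K f - S. g v) * matching_sum (R f) w' (K f - S)"
  shows "matching_sum (\<Union>f \<in> I. R f) w U =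
    (\<Prod>f \<in> I. \<Delta> f) * (\<Prod>v \<in> V. g v) * matching_sum (\<Union>f \<in> I. R f) w' V"
proof -
  have finU: "finite U" using fin U by auto
  moreover have VU: "V \<subseteq> U" using U V by auto
  ultimately have finV: "finite V" by (rule rev_finite_subset)
  define C where "C S = (\<lambda>f \<in> I. K f - S f)" for S
  have other: "\<exists>g \<in> I. g \<noteq> f \<and> v \<in> K g" if v: "v \<in> V" and "f \<in> I" "v \<in> K f" for f v
  proof -
    obtain f' g where "f' \<in> I" "g \<in> I" "f' \<noteq> g" "v \<in> K f'" "v \<in> K g"
      using v unfolding V by blast
    then show ?thesis by (cases "f' = f") auto
  qed
  \<comment> \<open>A vertex of \<open>K f - S f\<close> is owned by another cell, so the
    complements contain only vertices of two cells.\<close>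
  have bij: "C S \<in> assignments I K V" if S: "S \<in> assignments I K U" for S
  proof -
    have *: "\<exists>!f. f \<in> I \<and> v \<in> S f" if "v \<in> U" for v
      using S that by (simp add: assignments_def)
    have SK: "S f \<subseteq> K f" if "f \<in> I" for f using S that by (simp add: assignments_def)
    show ?thesis
      unfolding assignments_def C_def
    proof (intro CollectI conjI ballI)
      fix f assume f: "f \<in> I"
      show "(\<lambda>f \<in> I. K f - S f) f \<subseteq> K f \<inter> V"
      proof
        fix v assume v: "v \<in> (\<lambda>f \<in> I. K f - S f) f"
        then have v': "v \<in> K f" "v \<notin> S f" using f by auto
        then have "v \<in> U" using f U by auto
        then obtain g where "g \<in> I" "v \<in> S g" using *[of v] by blast
        moreover from this have "v \<in> K g" "g \<noteq> f" using v' SK by auto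
        ultimately have "v \<in> V" unfolding V using v'(1) f by blast
        then show "v \<in> K f \<inter> V" using v' by simp
      qed
    next
      fix v assume v: "v \<in> V"
      then have "v \<in> U" using VU by auto
      then obtain f where f: "f \<in> I" "v \<in> S f" "\<And>f'. f' \<in> I \<Longrightarrow> v \<in> S f' \<Longrightarrow> f' = f"
        using *[of v] by blast
      have "v \<in> K f" using f(1,2) SK by blast
      then obtain g where g: "g \<in> I" "g \<noteq> f" "v \<in> K g"
        using other[OF v f(1)] by blast
      show "\<exists>!f. f \<in> I \<and> v \<in> (\<lambda>f \<in> I. K f - S f) f"
      proof (rule ex1I[of _ g])
        show "g \<in> I \<and> v \<in> (\<lambda>f \<in> I. K f - S f) g" using g(1,3) f(3)[OF g(1)] g(2) by auto
        fix h assume "h \<in> I \<and> v \<in> (\<lambda>f \<in> I. K f - S f) h"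
        then have h: "h \<in> I" "v \<in> K h" "v \<notin> S h" by auto
          then have "h \<noteq> f" using f(2) by auto
          then show "h = g" using f(1) g h two[of f g h v] \<open>v \<in> K f\<close> by auto
      qed
    qed auto
  qed
  have bij': "C S \<in> assignments I K U" if S: "S \<in> assignments I K V" for S
  proof -
    have *: "\<exists>!f. f \<in> I \<and> v \<in> S f" if "v \<in> V" for v
      using S that by (simp add: assignments_def)
    have SK: "S f \<subseteq> K f \<inter> V" if "f \<in> I" for f using S that by (simp add: assignments_def)
    show ?thesis
      unfolding assignments_def C_def
    proof (intro CollectI conjI ballI)
      fix f assume f: "f \<in> I"
      then show "(\<lambda>f \<in> I. K f - S f) f \<subseteq> K f \<inter> U" using U by auto
    next
      fix v assume v: "v \<in> U"
      show "\<exists>!f. f \<in> I \<and> v \<in> (\<lambda>f \<in> I. K f - S f) f"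
      proof (cases "v \<in> V")
        case True
        then obtain f where f: "f \<in> I" "v \<in> S f" "\<And>f'. f' \<in> I \<Longrightarrow> v \<in> S f' \<Longrightarrow> f' = f"
          using *[of v] by blast
        have "v \<in> K f" using f(1,2) SK by blast
        then obtain g where g: "g \<in> I" "g \<noteq> f" "v \<in> K g"
          using other[OF True f(1)] by blast
        show ?thesis
        proof (rule ex1I[of _ g])
          show "g \<in> I \<and> v \<in> (\<lambda>f \<in> I. K f - S f) g" using g(1,3) f(3)[OF g(1)] g(2) by auto
          fix h assume "h \<in> I \<and> v \<in> (\<lambda>f \<in> I. K f - S f) h"
          then have h: "h \<in> I" "v \<in> K h" "v \<notin> S h" by auto
          then have "h \<noteq> f" using f(2) by auto
          then show "h = g" using f(1) g h two[of f g h v] \<open>v \<in> K f\<close> by auto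
        qed
      next
        \<comment> \<open>Here \<open>v\<close> lies in a single cell \<open>f\<close> and, being
          outside \<open>V\<close>, not in \<open>S f\<close>; the complement hands it to that
          cell.\<close>
        case False
        obtain f where f: "f \<in> I" "v \<in> K f" using v U by auto
        show ?thesis
        proof (rule ex1I[of _ f])
          show "f \<in> I \<and> v \<in> (\<lambda>f \<in> I. K f - S f) f" using f False SK by auto
          fix h assume "h \<in> I \<and> v \<in> (\<lambda>f \<in> I. K f - S f) h"
          then have "h \<in> I" "v \<in> K h" by auto
          then show "h = f" using f False unfolding V by blast
        qed
      qed
    qed auto
  qed
  have CC: "C (C S) = S" if "S \<in> assignments I K W" for S W
  proof
    fix f
    show "C (C S) f = S f"
    proof (cases "f \<in> I")
      case True
      then have "S f \<subseteq> K f" using that by (simp add: assignments_def)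
      then show ?thesis using True by (auto simp: C_def)
    next
      case False
      then have "S f = undefined" using that by (simp add: assignments_def PiE_iff extensional_def)
      then show ?thesis using False by (simp add: C_def)
    qed
  qed
  have "matching_sum (\<Union>f \<in> I. R f) w U =
      (\<Sum>S \<in> assignments I K U. \<Prod>f \<in> I. matching_sum (R f) w (S f))"
    by (rule matching_sum_assignments) (use fin finU disj ends in auto)
  also have "\<dots> = (\<Sum>S \<in> assignments I K V. \<Prod>f \<in> I. matching_sum (R f) w (C S f))"
    by (rule sum.reindex_bij_witness[where i = C and j = C]) (auto simp: CC bij bij')
  \<comment> \<open>By \<open>loc\<close> the cell \<open>f\<close> contributes the factors
    \<open>g v\<close> with \<open>v\<close> in \<open>S f\<close>. The sets \<open>S f\<close>
    partition \<open>V\<close>, so these factors have the same product for every assignment.\<close>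
  also have "\<dots> = (\<Sum>S \<in> assignments I K V. (\<Prod>f \<in> I. \<Delta> f) * (\<Prod>v \<in> V. g v) *
      (\<Prod>f \<in> I. matching_sum (R f) w' (S f)))"
  proof (rule sum.cong)
    fix S assume S: "S \<in> assignments I K V"
    have "(\<Prod>f \<in> I. matching_sum (R f) w (C S f)) =
        (\<Prod>f \<in> I. \<Delta> f * (\<Prod>v \<in> S f. g v) * matching_sum (R f) w' (S f))"
    proof (rule prod.cong)
      fix f assume f: "f \<in> I"
      then have "S f \<subseteq> K f" using S by (simp add: assignments_def)
      then have "K f - (K f - S f) = S f" by auto
      then show "matching_sum (R f) w (C S f) = \<Delta> f * (\<Prod>v \<in> S f. g v) * matching_sum (R f) w' (S f)"
        using loc[OF f, of "K f - S f"] f by (simp add: C_def)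
    qed simp
    then show "(\<Prod>f \<in> I. matching_sum (R f) w (C S f)) = (\<Prod>f \<in> I. \<Delta> f) * (\<Prod>v \<in> V. g v) *
      (\<Prod>f \<in> I. matching_sum (R f) w' (S f))"
      using prod_partition[OF S fin(1) finV, of g] by (simp add: prod.distrib)
  qed simp
  also have "\<dots> = (\<Prod>f \<in> I. \<Delta> f) * (\<Prod>v \<in> V. g v) *
      (\<Sum>S \<in> assignments I K V. \<Prod>f \<in> I. matching_sum (R f) w' (S f))"
    by (simp add: sum_distrib_left)
  also have "(\<Sum>S \<in> assignments I K V. \<Prod>f \<in> I. matching_sum (R f) w' (S f)) =
      matching_sum (\<Union>f \<in> I. R f) w' V"
    by (rule matching_sum_assignments[symmetric]) (use fin finV disj ends in auto)
  finally show ?thesis .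
qed

section \<open>Matchings of a 4-cycle\<close>

lemma matching_sum_empty: "matching_sum E w {} = 1"
proof -
  have "matchings {} (inner_arcs {} E) = {{}}"
    by (auto simp: matchings_def inner_arcs_def)
  then show ?thesis by (simp add: matching_sum_def)
qed

text \<open>Sort the matchings by their arc at \<open>v\<close>; deleting it leaves a matching of
  the other vertices. The two directions of an edge are separate terms.\<close>

lemma matching_sum_expand:
  assumes v: "v \<in> V" and E: "finite E"
  shows "matching_sum E w V =
    (\<Sum>e \<in> {e \<in> inner_arcs V E. v = fst e \<or> v = snd e}. w e * matching_sum E w (V - {fst e, snd e}))"
proof -
  define A where "A = {e \<in> inner_arcs V E. v = fst e \<or> v = snd e}"
  define L where "L e = matchings (V - {fst e, snd e}) (inner_arcs (V - {fst e, snd e}) E)" for e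
  define e0 where "e0 M = (THE e. e \<in> M \<and> (v = fst e \<or> v = snd e))" for M
  have finA: "finite A" using E by (auto simp: A_def inner_arcs_def)
  have finL: "finite (L e)" for e unfolding L_def by (rule finite_matchings[OF E])
  have notin: "e \<notin> M" if "M \<in> L e" for e M
    using that by (auto simp: L_def matchings_def inner_arcs_def)
  have e0: "e0 M \<in> M" "v = fst (e0 M) \<or> v = snd (e0 M)"
      "\<And>e. e \<in> M \<Longrightarrow> v = fst e \<or> v = snd e \<Longrightarrow> e = e0 M"
    if "M \<in> matchings V (inner_arcs V E)" for M
  proof -
    have ex: "\<exists>!e. e \<in> M \<and> (v = fst e \<or> v = snd e)"
      using that v by (simp add: matchings_def)
    show "e0 M \<in> M" "v = fst (e0 M) \<or> v = snd (e0 M)"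
      using theI'[OF ex] by (auto simp: e0_def)
    then show "e = e0 M" if "e \<in> M" "v = fst e \<or> v = snd e" for e
      using ex that by blast
  qed
  have "(\<Sum>e \<in> A. w e * matching_sum E w (V - {fst e, snd e})) =
      (\<Sum>e \<in> A. \<Sum>M \<in> L e. w e * (\<Prod>e \<in> M. w e))"
    by (simp add: matching_sum_def L_def sum_distrib_left)
  also have "\<dots> = (\<Sum>(e, M) \<in> Sigma A L. w e * (\<Prod>e \<in> M. w e))"
    by (rule sum.Sigma) (auto simp: finA finL)
  also have "\<dots> = (\<Sum>M \<in> matchings V (inner_arcs V E). \<Prod>e \<in> M. w e)"
  proof (rule sum.reindex_bij_witness[symmetric,
        where j = "\<lambda>M. (e0 M, M - {e0 M})" and i = "\<lambda>(e, M). insert e M"])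
    fix M assume M: "M \<in> matchings V (inner_arcs V E)"
    note e0 = e0[OF M]
    have sub: "M \<subseteq> inner_arcs V E" using M by (simp add: matchings_def)
    have uniq: "\<exists>!e. e \<in> M \<and> (u = fst e \<or> u = snd e)" if "u \<in> V" for u
      using M that by (simp add: matchings_def)
    have disj: "fst e \<notin> {fst (e0 M), snd (e0 M)} \<and> snd e \<notin> {fst (e0 M), snd (e0 M)}"
      if "e \<in> M" "e \<noteq> e0 M" for e
    proof -
      have "fst e \<in> V" "snd e \<in> V" using that sub by (auto simp: inner_arcs_def)
      then show ?thesis using uniq[of "fst e"] uniq[of "snd e"] e0(1) that by blast
    qed
    show "(case (e0 M, M - {e0 M}) of (e, M) \<Rightarrow> insert e M) = M"
      using e0(1) by auto
    have "M - {e0 M} \<in> L (e0 M)"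
      unfolding L_def matchings_def
    proof (intro CollectI conjI ballI)
      show "M - {e0 M} \<subseteq> inner_arcs (V - {fst (e0 M), snd (e0 M)}) E"
        using sub disj by (auto simp: inner_arcs_def)
      fix u assume u: "u \<in> V - {fst (e0 M), snd (e0 M)}"
      then have "\<exists>!e. e \<in> M \<and> (u = fst e \<or> u = snd e)" using uniq by auto
      then obtain e where e: "e \<in> M" "u = fst e \<or> u = snd e"
          "\<And>e'. e' \<in> M \<Longrightarrow> u = fst e' \<or> u = snd e' \<Longrightarrow> e' = e" by blast
      show "\<exists>!e. e \<in> M - {e0 M} \<and> (u = fst e \<or> u = snd e)"
      proof (rule ex1I[of _ e])
        show "e \<in> M - {e0 M} \<and> (u = fst e \<or> u = snd e)" using e(1,2) u by auto
      qed (use e(3) in blast)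
    qed
    moreover have "e0 M \<in> A" using e0(1,2) sub by (auto simp: A_def)
    ultimately show "(e0 M, M - {e0 M}) \<in> Sigma A L" by simp
    have "finite M"
      by (rule finite_subset[OF sub]) (use E in \<open>simp add: inner_arcs_def\<close>)
    then show "(case (e0 M, M - {e0 M}) of (e, M) \<Rightarrow> w e * prod w M) = prod w M"
      using e0(1) by (simp add: prod.remove)
  next
    fix eM assume "eM \<in> Sigma A L"
    then obtain e M where [simp]: "eM = (e, M)" and e: "e \<in> A" and M: "M \<in> L e" by auto
    have sub: "M \<subseteq> inner_arcs (V - {fst e, snd e}) E" using M by (simp add: L_def matchings_def)
    have uniq: "\<exists>!e'. e' \<in> M \<and> (u = fst e' \<or> u = snd e')" if "u \<in> V - {fst e, snd e}" for u
      using M that by (simp add: L_def matchings_def)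
    have ins: "insert e M \<in> matchings V (inner_arcs V E)"
      unfolding matchings_def
    proof (intro CollectI conjI ballI)
      show "insert e M \<subseteq> inner_arcs V E" using sub e by (auto simp: inner_arcs_def A_def)
      fix u assume u: "u \<in> V"
      show "\<exists>!e'. e' \<in> insert e M \<and> (u = fst e' \<or> u = snd e')"
      proof (cases "u = fst e \<or> u = snd e")
        case True
        show ?thesis
          by (rule ex1I[of _ e]) (use True sub in \<open>auto simp: inner_arcs_def\<close>)
      next
        case False
        then obtain e' where e': "e' \<in> M" "u = fst e' \<or> u = snd e'"
            "\<And>e''. e'' \<in> M \<Longrightarrow> u = fst e'' \<or> u = snd e'' \<Longrightarrow> e'' = e'"
          using uniq[of u] u by blast
        show ?thesis
        proof (rule ex1I[of _ e'])
          show "e' \<in> insert e M \<and> (u = fst e' \<or> u = snd e')" using e'(1,2) by blast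
        qed (use e'(3) False in blast)
      qed
    qed
    have "e = e0 (insert e M)"
      by (rule e0(3)[OF ins]) (use e in \<open>auto simp: A_def\<close>)
    then show "(\<lambda>M. (e0 M, M - {e0 M})) (case eM of (e, M) \<Rightarrow> insert e M) = eM"
      using notin[OF M] by simp
    show "(case eM of (e, M) \<Rightarrow> insert e M) \<in> matchings V (inner_arcs V E)"
      using ins by simp
  qed
  finally show ?thesis by (simp add: matching_sum_def A_def)
qed

definition cycle_arcs :: "'v \<Rightarrow> 'v \<Rightarrow> 'v \<Rightarrow> 'v \<Rightarrow> ('v \<times> 'v) set" where
  "cycle_arcs p q r s = {(p, q), (q, p), (q, r), (r, q), (r, s), (s, r), (s, p), (p, s)}"

text \<open>A matching chooses a direction for each of its edges, so that an undirected edge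
  contributes both weights.\<close>

definition edge_weight :: "('v \<times> 'v \<Rightarrow> complex) \<Rightarrow> 'v \<Rightarrow> 'v \<Rightarrow> complex" where
  "edge_weight w u v = w (u, v) + w (v, u)"

text \<open>The conditional form lets simplification evaluate the expansion for every concrete
  subset of the cycle.\<close>

lemma matching_sum_cycle_expand:
  fixes w :: "'v \<times> 'v \<Rightarrow> complex"
  assumes d: "p \<noteq> q" "p \<noteq> r" "p \<noteq> s" "q \<noteq> r" "q \<noteq> s" "r \<noteq> s" and v: "v \<in> V"
  shows "matching_sum (cycle_arcs p q r s) w V =
    (\<Sum>(a, b) \<leftarrow> [(p, q), (q, r), (r, s), (s, p)].
      if {a, b} \<subseteq> V \<and> v \<in> {a, b}
      then edge_weight w a b * matching_sum (cycle_arcs p q r s) w (V - {a, b}) else 0)"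
proof -
  define m where "m = matching_sum (cycle_arcs p q r s) w"
  define F where "F e = (if {fst e, snd e} \<subseteq> V \<and> v \<in> {fst e, snd e}
    then w e * m (V - {fst e, snd e}) else 0)" for e
  define G where "G a b = (if {a, b} \<subseteq> V \<and> v \<in> {a, b}
    then edge_weight w a b * m (V - {a, b}) else 0)" for a b
  have FG: "F (a, b) + F (b, a) = G a b" for a b
    by (auto simp: F_def G_def edge_weight_def insert_commute[of b a] distrib_right)
  have "m V = (\<Sum>e \<in> {e \<in> cycle_arcs p q r s. {fst e, snd e} \<subseteq> V \<and> v \<in> {fst e, snd e}}.
      w e * m (V - {fst e, snd e}))"
    unfolding m_def by (subst matching_sum_expand[OF v])
      (auto simp: cycle_arcs_def inner_arcs_def intro!: sum.cong)
  also have "\<dots> = (\<Sum>e \<in> cycle_arcs p q r s. F e)"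
    unfolding F_def by (rule sum.inter_filter) (simp add: cycle_arcs_def)
  also have "\<dots> = F (p, q) + F (q, p) + F (q, r) + F (r, q) + F (r, s) + F (s, r) + F (s, p) + F (p, s)"
    unfolding cycle_arcs_def using d by (simp add: add.assoc)
  also have "\<dots> = (\<Sum>(a, b) \<leftarrow> [(p, q), (q, r), (r, s), (s, p)]. G a b)"
    by (simp add: FG[symmetric] add.assoc)
  finally show ?thesis unfolding m_def G_def .
qed

text \<open>On a 4-cycle only the empty set, the four sides and the full set can be matched
  perfectly. Complementation preserves this list: it swaps opposite sides, and the empty with the
  full set. The six equations are these six cases.\<close>

lemma cycle_complement:
  assumes d: "p \<noteq> q" "p \<noteq> r" "p \<noteq> s" "q \<noteq> r" "q \<noteq> s" "r \<noteq> s"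
    and D: "\<Delta> = edge_weight w p q * edge_weight w r s + edge_weight w q r * edge_weight w s p"
    and e1: "edge_weight w p q = \<Delta> * (g r * g s * edge_weight w' r s)"
    and e2: "edge_weight w r s = \<Delta> * (g p * g q * edge_weight w' p q)"
    and e3: "edge_weight w q r = \<Delta> * (g p * g s * edge_weight w' s p)"
    and e4: "edge_weight w s p = \<Delta> * (g q * g r * edge_weight w' q r)"
    and e5: "1 = \<Delta> * (g p * g q * g r * g s *
       (edge_weight w' p q * edge_weight w' r s + edge_weight w' q r * edge_weight w' s p))"
    and S: "S \<subseteq> {p, q, r, s}"
  shows "matching_sum (cycle_arcs p q r s) w S =
    \<Delta> * (\<Prod>v \<in> {p, q, r, s} - S. g v) * matching_sum (cycle_arcs p q r s) w' ({p, q, r, s} - S)"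
proof -
  note ex = matching_sum_cycle_expand[OF d]
  have val: "matching_sum (cycle_arcs p q r s) w {p} = 0" "matching_sum (cycle_arcs p q r s) w {q} = 0"
    "matching_sum (cycle_arcs p q r s) w {r} = 0" "matching_sum (cycle_arcs p q r s) w {s} = 0"
    "matching_sum (cycle_arcs p q r s) w {p, q} = edge_weight w p q"
    "matching_sum (cycle_arcs p q r s) w {q, r} = edge_weight w q r"
    "matching_sum (cycle_arcs p q r s) w {r, s} = edge_weight w r s"
    "matching_sum (cycle_arcs p q r s) w {p, s} = edge_weight w s p"
    "matching_sum (cycle_arcs p q r s) w {p, r} = 0" "matching_sum (cycle_arcs p q r s) w {q, s} = 0"
    for w
    using d by (simp_all add: ex[of p "{p}"] ex[of q "{q}"] ex[of r "{r}"] ex[of s "{s}"]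
      ex[of p "{p, q}"] ex[of q "{q, r}"] ex[of r "{r, s}"] ex[of p "{p, s}"] ex[of p "{p, r}"]
      ex[of q "{q, s}"] matching_sum_empty insert_Diff_if)
  have val3: "matching_sum (cycle_arcs p q r s) w {p, q, r} = 0"
    "matching_sum (cycle_arcs p q r s) w {p, q, s} = 0"
    "matching_sum (cycle_arcs p q r s) w {p, r, s} = 0"
    "matching_sum (cycle_arcs p q r s) w {q, r, s} = 0"
    "matching_sum (cycle_arcs p q r s) w {p, q, r, s} =
       edge_weight w p q * edge_weight w r s + edge_weight w q r * edge_weight w s p" for w
    using d by (simp_all add: ex[of p "{p, q, r}"] ex[of p "{p, q, s}"] ex[of p "{p, r, s}"]
      ex[of q "{q, r, s}"] ex[of p "{p, q, r, s}"] val insert_Diff_if)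
  have "S \<in> Pow {p, q, r, s}" using S by simp
  then have "S \<in> {{}, {p}, {q}, {r}, {s}, {p, q}, {p, r}, {p, s}, {q, r}, {q, s}, {r, s},
      {p, q, r}, {p, q, s}, {p, r, s}, {q, r, s}, {p, q, r, s}}"
    by (simp add: Pow_insert insert_commute)
  then show ?thesis
  proof (elim insertE emptyE)
    assume "S = {p, q, r, s}"
    then show ?thesis using D by (simp add: val3 matching_sum_empty)
  qed (use d in \<open>simp_all add: val val3 matching_sum_empty insert_Diff_if
        del: mult_cancel_left mult_cancel_right\<close>,
      use e1 e2 e3 e4 e5[symmetric] in \<open>simp_all only: mult.assoc mult_1_left mult_1_right\<close>)
qed

section \<open>The local move at a face\<close>

lemma face_arcs_eq: "face_arcs (x, y) = cycle_arcs (x, y) (x + 1, y) (x + 1, y + 1) (x, y + 1)"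
  unfolding face_arcs_def cycle_arcs_def by (auto simp: abs_if split: if_splits)

text \<open>Directing the edges rightwards and upwards instead of from white to black reverses
  exactly two of them, whatever the colour of \<open>(x, y)\<close>, so the product of the signs
  stays -1.\<close>

lemma kasteleyn_face:
  assumes "kasteleyn k c \<phi>" and "(x, y) \<in> internal_faces k c"
  shows "(u, v) \<in> face_arcs (x, y) \<Longrightarrow> \<phi> (u, v) \<in> {-1, 1} \<and> \<phi> (v, u) = - \<phi> (u, v)"
    and "\<phi> ((x, y), (x + 1, y)) * \<phi> ((x + 1, y), (x + 1, y + 1)) *
      \<phi> ((x, y + 1), (x + 1, y + 1)) * \<phi> ((x, y), (x, y + 1)) = -1"
proof -
  have signs: "\<phi> (u, v) \<in> {-1, 1} \<and> \<phi> (v, u) = - \<phi> (u, v)" if "(u, v) \<in> face_arcs (x, y)" for u v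
    using assms that unfolding kasteleyn_def aztec_arcs_def by blast
  then show "(u, v) \<in> face_arcs (x, y) \<Longrightarrow> \<phi> (u, v) \<in> {-1, 1} \<and> \<phi> (v, u) = - \<phi> (u, v)" .
  have "{e \<in> face_arcs (x, y). white (fst e)} =
      (if even (x + y) then {((x, y), (x + 1, y)), ((x, y), (x, y + 1)),
         ((x + 1, y + 1), (x + 1, y)), ((x + 1, y + 1), (x, y + 1))}
       else {((x + 1, y), (x, y)), ((x + 1, y), (x + 1, y + 1)),
         ((x, y + 1), (x + 1, y + 1)), ((x, y + 1), (x, y))})"
    unfolding face_arcs_eq cycle_arcs_def by auto
  moreover have "(\<Prod>e \<in> {e \<in> face_arcs (x, y). white (fst e)}. \<phi> e) = -1"
    using assms unfolding kasteleyn_def by blast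
  ultimately show "\<phi> ((x, y), (x + 1, y)) * \<phi> ((x + 1, y), (x + 1, y + 1)) *
      \<phi> ((x, y + 1), (x + 1, y + 1)) * \<phi> ((x, y), (x, y + 1)) = -1"
    using signs[of "(x, y)" "(x + 1, y)"] signs[of "(x + 1, y)" "(x + 1, y + 1)"]
      signs[of "(x, y + 1)" "(x + 1, y + 1)"] signs[of "(x, y)" "(x, y + 1)"]
    by (simp add: face_arcs_eq cycle_arcs_def split: if_splits) (auto simp: mult_ac)
qed

section \<open>Edge weights and the dSKP relation\<close>

definition arc_weight :: "(arc \<Rightarrow> int) \<Rightarrow> (face \<Rightarrow> complex) \<Rightarrow> arc \<Rightarrow> complex" where
  "arc_weight \<phi> a e = of_int (\<phi> e) * a (right_face e)"

text \<open>Neighbours are named by compass directions. Up to a sign this is the partition function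
  of the boundary cycle of a face with weight \<open>d\<close>.\<close>

definition dskp_den :: "complex \<Rightarrow> complex \<Rightarrow> complex \<Rightarrow> complex \<Rightarrow> complex \<Rightarrow> complex" where
  "dskp_den d n e s w = (d - e) * (d - w) - (d - n) * (d - s)"

text \<open>\<open>u\<close> is the image of \<open>d\<close> under the Moebius involution that
  swaps \<open>n\<close> with \<open>s\<close> and \<open>e\<close> with \<open>w\<close>, with the
  denominator cleared. A nonzero denominator keeps \<open>u\<close> finite, and the four
  inequalities keep the vertex factors of the local move finite.\<close>

definition dskp :: "complex \<Rightarrow> complex \<Rightarrow> complex \<Rightarrow> complex \<Rightarrow> complex \<Rightarrow> complex \<Rightarrow> bool" where
  "dskp d n e s w u \<longleftrightarrow> dskp_den d n e s w \<noteq> 0 \<and>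
     dskp_den d n e s w * u = (d - n) * (s - e) * w - (n - w) * (e - d) * s \<and>
     n \<noteq> e \<and> n \<noteq> w \<and> s \<noteq> e \<and> s \<noteq> w"

text \<open>After clearing the denominator, each difference between \<open>u\<close> and a neighbour
  factors into differences of old weights. The last identity concerns \<open>dskp_den\<close> with
  \<open>u\<close> in place of \<open>d\<close>.\<close>

lemma dskp_differences:
  assumes "dskp d n e s w u"
  shows "dskp_den d n e s w * (u - n) = - ((d - s) * (n - e) * (n - w))"
    and "dskp_den d n e s w * (s - u) = (d - n) * (s - w) * (s - e)"
    and "dskp_den d n e s w * (u - e) = (d - w) * (n - e) * (s - e)"
    and "dskp_den d n e s w * (u - w) = (d - e) * (n - w) * (s - w)"
    and "dskp_den d n e s w * ((u - e) * (u - w) - (u - n) * (u - s)) =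
      (n - e) * (n - w) * (s - e) * (s - w)"
proof -
  let ?D = "dskp_den d n e s w"
  have D: "?D * u = (d - n) * (s - e) * w - (n - w) * (e - d) * s" "?D \<noteq> 0"
    using assms by (auto simp: dskp_def)
  show 1: "?D * (u - n) = - ((d - s) * (n - e) * (n - w))" "?D * (s - u) = (d - n) * (s - w) * (s - e)"
    "?D * (u - e) = (d - w) * (n - e) * (s - e)" "?D * (u - w) = (d - e) * (n - w) * (s - w)"
    unfolding right_diff_distrib[of ?D] D(1) by (simp_all add: dskp_den_def algebra_simps)
  \<comment> \<open>A second factor \<open>?D\<close> lets both products be rewritten by the four
    identities above; being nonzero, it cancels afterwards.\<close>
  have "?D * (?D * ((u - e) * (u - w) - (u - n) * (u - s))) =
      (?D * (u - e)) * (?D * (u - w)) + (?D * (u - n)) * (?D * (s - u))"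
    by (simp add: algebra_simps)
  also have "\<dots> = ?D * ((n - e) * (n - w) * (s - e) * (s - w))"
    unfolding 1 by (simp add: dskp_den_def algebra_simps)
  finally show "?D * ((u - e) * (u - w) - (u - n) * (u - s)) = (n - e) * (n - w) * (s - e) * (s - w)"
    using D(2) by simp
qed

text \<open>Inversion interchanges the numerator and the denominator of \<open>u\<close>, up to the
  product of the five weights.\<close>

lemma dskp_den_inverse:
  assumes "dskp d n e s w u" and nz: "d \<noteq> 0" "n \<noteq> 0" "e \<noteq> 0" "s \<noteq> 0" "w \<noteq> 0"
  shows "dskp_den (inverse d) (inverse n) (inverse e) (inverse s) (inverse w) =
    dskp_den d n e s w * (u / (d * n * e * s * w))"
proof -
  have "dskp_den d n e s w * u = (d - n) * (s - e) * w - (n - w) * (e - d) * s"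
    using assms by (simp add: dskp_def)
  then have "dskp_den d n e s w * (u / (d * n * e * s * w)) =
      ((d - n) * (s - e) * w - (n - w) * (e - d) * s) / (d * n * e * s * w)" by simp
  also have "\<dots> = dskp_den (inverse d) (inverse n) (inverse e) (inverse s) (inverse w)"
    using nz unfolding dskp_den_def by (simp add: field_simps)
  finally show ?thesis by simp
qed

lemma dskp_inverse:
  assumes "dskp d n e s w u"
    and nz: "d \<noteq> 0" "n \<noteq> 0" "e \<noteq> 0" "s \<noteq> 0" "w \<noteq> 0" "u \<noteq> 0"
  shows "dskp (inverse d) (inverse n) (inverse e) (inverse s) (inverse w) (inverse u)"
proof -
  note D = dskp_den_inverse[OF assms(1) nz(1-5)]
  have "dskp_den (inverse d) (inverse n) (inverse e) (inverse s) (inverse w) * inverse u =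
      dskp_den d n e s w / (d * n * e * s * w)"
    unfolding D using nz by (simp add: field_simps)
  also have "\<dots> = (inverse d - inverse n) * (inverse s - inverse e) * inverse w
      - (inverse n - inverse w) * (inverse e - inverse d) * inverse s"
    using nz by (simp add: dskp_den_def field_simps)
  finally have eq: "dskp_den (inverse d) (inverse n) (inverse e) (inverse s) (inverse w) * inverse u =
    (inverse d - inverse n) * (inverse s - inverse e) * inverse w
      - (inverse n - inverse w) * (inverse e - inverse d) * inverse s" .
  have "dskp_den d n e s w \<noteq> 0" using assms by (simp add: dskp_def)
  then have "dskp_den (inverse d) (inverse n) (inverse e) (inverse s) (inverse w) \<noteq> 0"
    using nz by (simp add: D)
  with eq show ?thesis using assms(1) by (simp add: dskp_def)
qed

text \<open>The two directions of an edge carry opposite signs and see the faces on its two sides,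
  so its weight is a signed difference of face weights. By \<open>dskp_differences\<close>,
  replacing \<open>d\<close> by \<open>u\<close> turns the difference at an edge into the old one at
  the opposite edge, up to a product of two factors \<open>g\<close>. This is the form that
  \<open>cycle_complement\<close> demands; \<open>\<epsilon>\<close> cancels because the factors
  come in even number.\<close>

lemma face_complement:
  assumes K: "kasteleyn k c \<phi>" "(x, y) \<in> internal_faces k c"
    and a': "a' (x, y) = u" "a' (x, y + 1) = n" "a' (x + 1, y) = e" "a' (x, y - 1) = s" "a' (x - 1, y) = w"
    and a: "a (x, y) = d" "a (x, y + 1) = n" "a (x + 1, y) = e" "a (x, y - 1) = s" "a (x - 1, y) = w"
    and dskp: "dskp d n e s w u"
    and g: "g (x, y) * (s - w) = \<epsilon>" "g (x + 1, y) * (s - e) = \<epsilon>"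
      "g (x + 1, y + 1) * (n - e) = \<epsilon>" "g (x, y + 1) * (n - w) = \<epsilon>" "\<epsilon> * \<epsilon> = 1"
    and \<Delta>: "\<Delta> = - of_int (\<phi> ((x + 1, y), (x + 1, y + 1)) * \<phi> ((x, y), (x, y + 1))) * dskp_den d n e s w"
    and S: "S \<subseteq> corners (x, y)"
  shows "matching_sum (face_arcs (x, y)) (arc_weight \<phi> a) S =
    \<Delta> * (\<Prod>v \<in> corners (x, y) - S. g v) *
      matching_sum (face_arcs (x, y)) (arc_weight \<phi> a') (corners (x, y) - S)"
proof -
  define p q r t where v: "p = (x, y)" "q = (x + 1, y)" "r = (x + 1, y + 1)" "t = (x, y + 1)"
  \<comment> \<open>The signs of the south, east, north and west edge, each directed rightwards or
    upwards.\<close>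
  define fS fE fN fW :: complex where f: "fS = of_int (\<phi> (p, q))" "fE = of_int (\<phi> (q, r))"
    "fN = of_int (\<phi> (t, r))" "fW = of_int (\<phi> (p, t))"
  note sg = kasteleyn_face(1)[OF K]
  have "fS * fE * fN * fW = of_int (\<phi> (p, q) * \<phi> (q, r) * \<phi> (t, r) * \<phi> (p, t))"
    by (simp add: f)
  also have "\<dots> = -1" unfolding v kasteleyn_face(2)[OF K] by simp
  finally have prod: "fS * fE * fN * fW = -1" .
  have "\<phi> (p, q) \<in> {-1, 1} \<and> \<phi> (q, p) = - \<phi> (p, q)" "\<phi> (q, r) \<in> {-1, 1} \<and> \<phi> (r, q) = - \<phi> (q, r)"
    "\<phi> (t, r) \<in> {-1, 1} \<and> \<phi> (r, t) = - \<phi> (t, r)" "\<phi> (p, t) \<in> {-1, 1} \<and> \<phi> (t, p) = - \<phi> (p, t)"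
    by (rule sg; simp add: v face_arcs_eq cycle_arcs_def)+
  then have rev: "\<phi> (q, p) = - \<phi> (p, q)" "\<phi> (r, q) = - \<phi> (q, r)" "\<phi> (r, t) = - \<phi> (t, r)"
      "\<phi> (t, p) = - \<phi> (p, t)"
    and sq: "fS * fS = 1" "fE * fE = 1" "fN * fN = 1" "fW * fW = 1"
    by (auto simp: f)
  have ew: "edge_weight (arc_weight \<phi> b) p q = fS * (b (x, y - 1) - b (x, y))"
    "edge_weight (arc_weight \<phi> b) q r = fE * (b (x + 1, y) - b (x, y))"
    "edge_weight (arc_weight \<phi> b) r t = fN * (b (x, y) - b (x, y + 1))"
    "edge_weight (arc_weight \<phi> b) t p = fW * (b (x, y) - b (x - 1, y))" for b
    using rev by (simp_all add: edge_weight_def arc_weight_def f v algebra_simps)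
  let ?D = "dskp_den d n e s w"
  have \<Delta>': "\<Delta> = - (fE * fW * ?D)" unfolding \<Delta> f v by simp
  \<comment> \<open>Multiplication by \<open>fE * fW\<close> turns the sign of an edge into plus or
    minus that of the opposite edge.\<close>
  have f1: "fE * fW * fN = - fS" "fE * fW * fS = - fN" using prod sq by - (algebra+)
  have f2: "fE * fW * fE = fW" "fE * fW * fW = fE" using sq by - (algebra+)
  have pm: "a * b * (c * d) = 1" if "a * c = \<epsilon>" "b * d = \<epsilon>" for a b c d
  proof -
    have "(a * c) * (b * d) = 1" using that g(5) by simp
    then show ?thesis by (simp add: mult_ac)
  qed
  have gg: "g r * g t * ((n - e) * (n - w)) = 1" "g p * g q * ((s - w) * (s - e)) = 1"
    "g p * g t * ((s - w) * (n - w)) = 1" "g q * g r * ((s - e) * (n - e)) = 1"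
    unfolding v by (rule pm; rule g)+
  note df = dskp_differences[OF dskp]
  \<comment> \<open>The factors \<open>g\<close> cancel the differences between neighbours in
    \<open>df\<close> and leave the old difference at the opposite edge.\<close>
  have h: "g r * g t * (?D * (u - n)) = s - d" "g p * g q * (?D * (s - u)) = d - n"
    "g q * g r * (?D * (u - e)) = d - w" "g p * g t * (?D * (u - w)) = d - e"
    "g p * g q * g r * g t * (?D * ((u - e) * (u - w) - (u - n) * (u - s))) = 1"
    unfolding df using gg by - (algebra+)
  have arcs: "face_arcs (x, y) = cycle_arcs p q r t" and co: "corners (x, y) = {p, q, r, t}"
    by (auto simp: face_arcs_eq v)
  show ?thesis
    unfolding arcs co
  proof (rule cycle_complement)
    show "\<Delta> = edge_weight (arc_weight \<phi> a) p q * edge_weight (arc_weight \<phi> a) r t +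
        edge_weight (arc_weight \<phi> a) q r * edge_weight (arc_weight \<phi> a) t p"
      unfolding \<Delta>' ew a dskp_den_def using prod sq by algebra
    show "edge_weight (arc_weight \<phi> a) p q = \<Delta> * (g r * g t * edge_weight (arc_weight \<phi> a') r t)"
      unfolding \<Delta>' ew a a' using h(1) f1 by algebra
    show "edge_weight (arc_weight \<phi> a) r t = \<Delta> * (g p * g q * edge_weight (arc_weight \<phi> a') p q)"
      unfolding \<Delta>' ew a a' using h(2) f1 by algebra
    show "edge_weight (arc_weight \<phi> a) q r = \<Delta> * (g p * g t * edge_weight (arc_weight \<phi> a') t p)"
      unfolding \<Delta>' ew a a' using h(4) f2 by algebra
    show "edge_weight (arc_weight \<phi> a) t p = \<Delta> * (g q * g r * edge_weight (arc_weight \<phi> a') q r)"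
      unfolding \<Delta>' ew a a' using h(3) f2 by algebra
    have "\<Delta> * (g p * g q * g r * g t *
        (edge_weight (arc_weight \<phi> a') p q * edge_weight (arc_weight \<phi> a') r t +
         edge_weight (arc_weight \<phi> a') q r * edge_weight (arc_weight \<phi> a') t p)) =
        g p * g q * g r * g t * (?D * ((u - e) * (u - w) - (u - n) * (u - s)))"
    proof -
      have "- (fE * fW) * (fS * (s - u) * (fN * (u - n)) + fE * (e - u) * (fW * (u - w))) =
          (u - e) * (u - w) - (u - n) * (u - s)"
        using prod sq by algebra
      then show ?thesis unfolding \<Delta>' ew a' by algebra
    qed
    then show "1 = \<Delta> * (g p * g q * g r * g t *
        (edge_weight (arc_weight \<phi> a') p q * edge_weight (arc_weight \<phi> a') r t +
         edge_weight (arc_weight \<phi> a') q r * edge_weight (arc_weight \<phi> a') t p))"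
      using h(5) by simp
    show "S \<subseteq> {p, q, r, t}" using S by (auto simp: v)
  qed (auto simp: v)
qed

section \<open>Shuffling the Aztec diamond\<close>

text \<open>The vertex is the point \<open>(x - 1/2, y - 1/2)\<close>; doubling makes its distance
  from the centre integral. The witness for the converse is the incident face nearest to the
  centre.\<close>

lemma aztec_vertices_iff:
  "(x, y) \<in> aztec_vertices k (i, j) \<longleftrightarrow> \<bar>2 * (x - i) - 1\<bar> + \<bar>2 * (y - j) - 1\<bar> \<le> 2 * int k"
proof
  assume "(x, y) \<in> aztec_vertices k (i, j)"
  then obtain s t where "\<bar>s - i\<bar> + \<bar>t - j\<bar> < int k" "(x, y) \<in> corners (s, t)"
    unfolding aztec_vertices_def by auto
  then show "\<bar>2 * (x - i) - 1\<bar> + \<bar>2 * (y - j) - 1\<bar> \<le> 2 * int k"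
    by (auto simp: abs_if split: if_splits)
next
  assume le: "\<bar>2 * (x - i) - 1\<bar> + \<bar>2 * (y - j) - 1\<bar> \<le> 2 * int k"
  define s where "s = (if x > i then x - 1 else x)"
  define t where "t = (if y > j then y - 1 else y)"
  have "\<bar>s - i\<bar> + \<bar>t - j\<bar> < int k" "(x, y) \<in> corners (s, t)"
    using le by (auto simp: s_def t_def abs_if split: if_splits)
  then show "(x, y) \<in> aztec_vertices k (i, j)"
    unfolding aztec_vertices_def by force
qed

text \<open>The cells of the decomposition: the internal faces of the diamond of size
  \<open>k + 1\<close> that have the colour of the outermost ones. Each edge of that diamond borders
  exactly one of them.\<close>

definition active_faces :: "nat \<Rightarrow> face \<Rightarrow> face set" where
  "active_faces k c = {(x, y). \<bar>x - fst c\<bar> + \<bar>y - snd c\<bar> \<le> int k \<and> even (x + y + fst c + snd c + int k)}"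

lemma adjacent_cases:
  "adjacent u v \<longleftrightarrow> (\<exists>x y. (u, v) \<in> {((x, y), (x + 1, y)), ((x + 1, y), (x, y)),
    ((x, y), (x, y + 1)), ((x, y + 1), (x, y))})"
proof -
  obtain x y x' y' where uv: "u = (x, y)" "v = (x', y')" by (metis surj_pair)
  have "\<bar>x' - x\<bar> + \<bar>y' - y\<bar> = 1 \<longleftrightarrow>
     (x' = x + 1 \<and> y' = y \<or> x = x' + 1 \<and> y' = y \<or> x' = x \<and> y' = y + 1 \<or> x' = x \<and> y = y' + 1)"
    by arith
  then show ?thesis unfolding uv by auto
qed

lemma face_arcs_iff:
  "((x, y), (x + 1, y)) \<in> face_arcs (s, t) \<longleftrightarrow> s = x \<and> (t = y \<or> t = y - 1)"
  "((x + 1, y), (x, y)) \<in> face_arcs (s, t) \<longleftrightarrow> s = x \<and> (t = y \<or> t = y - 1)"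
  "((x, y), (x, y + 1)) \<in> face_arcs (s, t) \<longleftrightarrow> (s = x \<or> s = x - 1) \<and> t = y"
  "((x, y + 1), (x, y)) \<in> face_arcs (s, t) \<longleftrightarrow> (s = x \<or> s = x - 1) \<and> t = y"
  by (auto simp: face_arcs_def)

lemma face_arcs_adjacent: "(u, v) \<in> face_arcs f \<Longrightarrow> adjacent u v"
  by (cases f) (simp add: face_arcs_def)

text \<open>If both ends of an edge are in the diamond, the face beside it nearer to the centre is
  internal. The diamond is thus an induced subgraph, which is what \<open>inner_arcs\<close>
  expects.\<close>

lemma aztec_arcs_iff:
  "(u, v) \<in> aztec_arcs k c \<longleftrightarrow> adjacent u v \<and> u \<in> aztec_vertices k c \<and> v \<in> aztec_vertices k c"
proof -
  obtain i j where c: "c = (i, j)" by (cases c)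
  have ends: "u \<in> aztec_vertices k c \<and> v \<in> aztec_vertices k c" if "(u, v) \<in> aztec_arcs k c"
    using that unfolding aztec_arcs_def aztec_vertices_def face_arcs_def by blast
  have hor: "\<exists>t. \<bar>x - i\<bar> + \<bar>t - j\<bar> < int k \<and> (t = y \<or> t = y - 1)"
    if "(x, y) \<in> aztec_vertices k c" "(x + 1, y) \<in> aztec_vertices k c" for x y
    by (rule exI[of _ "if y > j then y - 1 else y"])
      (use that in \<open>auto simp: c aztec_vertices_iff abs_if split: if_splits\<close>)
  have ver: "\<exists>s. \<bar>s - i\<bar> + \<bar>y - j\<bar> < int k \<and> (s = x \<or> s = x - 1)"
    if "(x, y) \<in> aztec_vertices k c" "(x, y + 1) \<in> aztec_vertices k c" for x y
    by (rule exI[of _ "if x > i then x - 1 else x"])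
      (use that in \<open>auto simp: c aztec_vertices_iff abs_if split: if_splits\<close>)
  have "(u, v) \<in> aztec_arcs k c"
    if "adjacent u v" "u \<in> aztec_vertices k c" "v \<in> aztec_vertices k c"
    using that(1) unfolding adjacent_cases
  proof (elim exE insertE emptyE)
    fix x y assume "(u, v) = ((x, y), (x + 1, y))"
    then show ?thesis using hor[of x y] that(2,3)
      by (auto simp: aztec_arcs_def c face_arcs_iff)
  next
    fix x y assume "(u, v) = ((x + 1, y), (x, y))"
    then show ?thesis using hor[of x y] that(2,3)
      by (auto simp: aztec_arcs_def c face_arcs_iff)
  next
    fix x y assume "(u, v) = ((x, y), (x, y + 1))"
    then show ?thesis using ver[of x y] that(2,3)
      by (auto simp: aztec_arcs_def c face_arcs_iff)
  next
    fix x y assume "(u, v) = ((x, y + 1), (x, y))"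
    then show ?thesis using ver[of x y] that(2,3)
      by (auto simp: aztec_arcs_def c face_arcs_iff)
  qed
  then show ?thesis
    using ends face_arcs_adjacent unfolding aztec_arcs_def by blast
qed

text \<open>\<open>P\<close> and \<open>Q\<close> are the distances of the two faces beside an edge.
  By parity \<open>Q \<le> k\<close> means \<open>Q \<le> k - 1\<close>, whence
  \<open>P \<le> k\<close>.\<close>

lemma parity_bound:
  fixes P Q k :: int
  assumes "even (P + k)" "odd (Q + k)" "P \<le> Q + 1" "P \<le> k \<or> Q \<le> k"
  shows "P \<le> k"
  using assms by presburger

text \<open>The two faces beside an edge have different colours, so one of them has the active
  colour, and \<open>parity_bound\<close> keeps it in range.\<close>

lemma active_arcs_iff:
  assumes "u \<in> aztec_vertices (Suc k) c" "v \<in> aztec_vertices (Suc k) c"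
  shows "(u, v) \<in> (\<Union>f \<in> active_faces k c. face_arcs f) \<longleftrightarrow> adjacent u v"
proof -
  obtain i j where c: "c = (i, j)" by (cases c)
  have hor: "\<exists>t. (x, t) \<in> active_faces k c \<and> (t = y \<or> t = y - 1)"
    if "(x, y) \<in> aztec_vertices (Suc k) c" "(x + 1, y) \<in> aztec_vertices (Suc k) c" for x y
  proof -
    have b: "\<bar>x - i\<bar> + \<bar>y - j\<bar> \<le> int k \<or> \<bar>x - i\<bar> + \<bar>y - 1 - j\<bar> \<le> int k"
      using that by (auto simp: c aztec_vertices_iff abs_if split: if_splits)
    show ?thesis
    proof (cases "even (x + y + i + j + int k)")
      case True
      have "\<bar>x - i\<bar> + \<bar>y - j\<bar> \<le> int k"
        by (rule parity_bound[OF _ _ _ b]) (use True in auto)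
      then show ?thesis using True by (auto simp: active_faces_def c)
    next
      case False
      have "\<bar>x - i\<bar> + \<bar>y - 1 - j\<bar> \<le> int k"
        by (rule parity_bound[OF _ _ _ b[unfolded disj_commute[of "\<bar>x - i\<bar> + \<bar>y - j\<bar> \<le> _"]]]) (use False in auto)
      then show ?thesis using False by (intro exI[of _ "y - 1"]) (auto simp: active_faces_def c)
    qed
  qed
  have ver: "\<exists>s. (s, y) \<in> active_faces k c \<and> (s = x \<or> s = x - 1)"
    if "(x, y) \<in> aztec_vertices (Suc k) c" "(x, y + 1) \<in> aztec_vertices (Suc k) c" for x y
  proof -
    have b: "\<bar>x - i\<bar> + \<bar>y - j\<bar> \<le> int k \<or> \<bar>x - 1 - i\<bar> + \<bar>y - j\<bar> \<le> int k"
      using that by (auto simp: c aztec_vertices_iff abs_if split: if_splits)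
    show ?thesis
    proof (cases "even (x + y + i + j + int k)")
      case True
      have "\<bar>x - i\<bar> + \<bar>y - j\<bar> \<le> int k"
        by (rule parity_bound[OF _ _ _ b]) (use True in auto)
      then show ?thesis using True by (auto simp: active_faces_def c)
    next
      case False
      have "\<bar>x - 1 - i\<bar> + \<bar>y - j\<bar> \<le> int k"
        by (rule parity_bound[OF _ _ _ b[unfolded disj_commute[of "\<bar>x - i\<bar> + \<bar>y - j\<bar> \<le> _"]]]) (use False in auto)
      then show ?thesis using False by (intro exI[of _ "x - 1"]) (auto simp: active_faces_def c)
    qed
  qed
  have "(u, v) \<in> (\<Union>f \<in> active_faces k c. face_arcs f)" if "adjacent u v"
    using that unfolding adjacent_cases
  proof (elim exE insertE emptyE)
    fix x y assume "(u, v) = ((x, y), (x + 1, y))"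
    then show ?thesis using hor[of x y] assms
      by (auto simp: Bex_def face_arcs_iff)
  next
    fix x y assume "(u, v) = ((x + 1, y), (x, y))"
    then show ?thesis using hor[of x y] assms
      by (auto simp: Bex_def face_arcs_iff)
  next
    fix x y assume "(u, v) = ((x, y), (x, y + 1))"
    then show ?thesis using ver[of x y] assms
      by (auto simp: Bex_def face_arcs_iff)
  next
    fix x y assume "(u, v) = ((x, y + 1), (x, y))"
    then show ?thesis using ver[of x y] assms
      by (auto simp: Bex_def face_arcs_iff)
  qed
  then show ?thesis using face_arcs_adjacent by blast
qed

lemma aztec_vertices_mono: "aztec_vertices k c \<subseteq> aztec_vertices (Suc k) c"
  by (cases c) (clarsimp simp: aztec_vertices_iff)

text \<open>One arc set serves both sizes, which then differ only in the vertex set; this makes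
  complementation applicable.\<close>

lemma dimer_Z_eq_matching_sum:
  assumes "l = k \<or> l = Suc k"
  shows "dimer_Z l c a \<phi> =
    matching_sum (\<Union>f \<in> active_faces k c. face_arcs f) (arc_weight \<phi> a) (aztec_vertices l c)"
proof -
  have "aztec_vertices l c \<subseteq> aztec_vertices (Suc k) c"
    using assms aztec_vertices_mono[of k c] by auto
  then have "(u, v) \<in> aztec_arcs l c \<longleftrightarrow>
      (u, v) \<in> inner_arcs (aztec_vertices l c) (\<Union>f \<in> active_faces k c. face_arcs f)" for u v
    using active_arcs_iff[of u k c v]
    by (cases "u \<in> aztec_vertices l c \<and> v \<in> aztec_vertices l c")
      (auto simp del: UN_iff adjacent.simps simp: aztec_arcs_iff inner_arcs_def)
  then have "aztec_arcs l c = inner_arcs (aztec_vertices l c) (\<Union>f \<in> active_faces k c. face_arcs f)"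
    by auto
  then show ?thesis
    by (simp add: dimer_Z_def oriented_dimers_def matching_sum_def matchings_def arc_weight_def)
qed

lemma corners_iff: "(x, y) \<in> corners (s, t) \<longleftrightarrow> (s = x \<or> s = x - 1) \<and> (t = y \<or> t = y - 1)"
  by auto

text \<open>The four faces at a vertex form two diagonal pairs of different colour, and only one
  pair can be active. Its distances \<open>P\<close> and \<open>Q\<close> have the parity of
  \<open>k\<close>, differ by at most 2, and add up to the doubled distance of the vertex. Hence
  \<open>P + Q \<le> 2 * k + 2\<close> holds iff one of them is at most \<open>k\<close>, and
  \<open>P + Q \<le> 2 * k\<close> iff both are.\<close>

lemma aztec_vertex_active:
  shows "(x, y) \<in> aztec_vertices (Suc k) c \<longleftrightarrow>
      (x, y) \<in> active_faces k c \<or> (x - 1, y - 1) \<in> active_faces k c \<or>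
      (x - 1, y) \<in> active_faces k c \<or> (x, y - 1) \<in> active_faces k c" (is ?A)
    and "(x, y) \<in> aztec_vertices k c \<longleftrightarrow>
      (x, y) \<in> active_faces k c \<and> (x - 1, y - 1) \<in> active_faces k c \<or>
      (x - 1, y) \<in> active_faces k c \<and> (x, y - 1) \<in> active_faces k c" (is ?B)
proof -
  obtain i j where c: "c = (i, j)" by (cases c)
  define P where "P = \<bar>x - i\<bar> + \<bar>y - j\<bar>"
  define Q where "Q = \<bar>x - 1 - i\<bar> + \<bar>y - 1 - j\<bar>"
  define P' where "P' = \<bar>x - 1 - i\<bar> + \<bar>y - j\<bar>"
  define Q' where "Q' = \<bar>x - i\<bar> + \<bar>y - 1 - j\<bar>"
  have sum: "\<bar>2 * (x - i) - 1\<bar> + \<bar>2 * (y - j) - 1\<bar> = P + Q"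
    "\<bar>2 * (x - i) - 1\<bar> + \<bar>2 * (y - j) - 1\<bar> = P' + Q'"
    and near: "\<bar>P - Q\<bar> \<le> 2" "\<bar>P' - Q'\<bar> \<le> 2"
  proof -
    have *: "\<bar>2 * a - 1\<bar> = \<bar>a\<bar> + \<bar>a - 1\<bar>" "\<bar>\<bar>a\<bar> - \<bar>a - 1\<bar>\<bar> \<le> 1" for a :: int
      by arith+
    have key: "S + T = (A + B) + (A' + B') \<and> S + T = (A' + B) + (A + B') \<and>
        \<bar>(A + B) - (A' + B')\<bar> \<le> 2 \<and> \<bar>(A' + B) - (A + B')\<bar> \<le> 2"
      if "S = A + A'" "T = B + B'" "\<bar>A - A'\<bar> \<le> 1" "\<bar>B - B'\<bar> \<le> 1" for A A' B B' S T :: int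
      using that by linarith
    have eq: "x - 1 - i = x - i - 1" "y - 1 - j = y - j - 1" by simp_all
    from key[OF *(1)[of "x - i"] *(1)[of "y - j"] *(2)[of "x - i"] *(2)[of "y - j"]]
    show "\<bar>2 * (x - i) - 1\<bar> + \<bar>2 * (y - j) - 1\<bar> = P + Q"
      "\<bar>2 * (x - i) - 1\<bar> + \<bar>2 * (y - j) - 1\<bar> = P' + Q'"
      "\<bar>P - Q\<bar> \<le> 2" "\<bar>P' - Q'\<bar> \<le> 2"
      unfolding P_def Q_def P'_def Q'_def eq by blast+
  qed
  have par: "even (P + int k) \<longleftrightarrow> even (x + y + i + j + int k)"
    "even (Q + int k) \<longleftrightarrow> even (x + y + i + j + int k)"
    "even (P' + int k) \<longleftrightarrow> odd (x + y + i + j + int k)"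
    "even (Q' + int k) \<longleftrightarrow> odd (x + y + i + j + int k)"
    unfolding P_def Q_def P'_def Q'_def by auto
  have act: "(x, y) \<in> active_faces k c \<longleftrightarrow> P \<le> int k \<and> even (x + y + i + j + int k)"
    "(x - 1, y - 1) \<in> active_faces k c \<longleftrightarrow> Q \<le> int k \<and> even (x + y + i + j + int k)"
    "(x - 1, y) \<in> active_faces k c \<longleftrightarrow> P' \<le> int k \<and> odd (x + y + i + j + int k)"
    "(x, y - 1) \<in> active_faces k c \<longleftrightarrow> Q' \<le> int k \<and> odd (x + y + i + j + int k)"
    unfolding active_faces_def c P_def Q_def P'_def Q'_def by auto
  have even: "P + Q \<le> 2 * int k + 2 \<longleftrightarrow> P \<le> int k \<or> Q \<le> int k"
      "P + Q \<le> 2 * int k \<longleftrightarrow> P \<le> int k \<and> Q \<le> int k"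
    if "even (P + int k)" "even (Q + int k)" "\<bar>P - Q\<bar> \<le> 2" for P Q
    using that by presburger+
  have V: "(x, y) \<in> aztec_vertices (Suc k) c \<longleftrightarrow> P + Q \<le> 2 * int k + 2"
    "(x, y) \<in> aztec_vertices k c \<longleftrightarrow> P + Q \<le> 2 * int k"
    unfolding c aztec_vertices_iff sum(1) by (simp_all add: add.commute)
  have V': "(x, y) \<in> aztec_vertices (Suc k) c \<longleftrightarrow> P' + Q' \<le> 2 * int k + 2"
    "(x, y) \<in> aztec_vertices k c \<longleftrightarrow> P' + Q' \<le> 2 * int k"
    unfolding c aztec_vertices_iff sum(2) by (simp_all add: add.commute)
  have "?A \<and> ?B"
  proof (cases "even (x + y + i + j + int k)")
    case True
    then have "even (P + int k)" "even (Q + int k)" using par(1,2) by blast+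
    note e = even[OF this near(1)]
    show ?thesis unfolding V act e using True by blast
  next
    case False
    then have "even (P' + int k)" "even (Q' + int k)" using par(3,4) by blast+
    note e = even[OF this near(2)]
    show ?thesis unfolding V' act e using False by blast
  qed
  then show ?A ?B by blast+
qed

lemma aztec_vertices_Suc_eq: "aztec_vertices (Suc k) c = (\<Union>f \<in> active_faces k c. corners f)"
proof -
  have "(x, y) \<in> aztec_vertices (Suc k) c \<longleftrightarrow> (x, y) \<in> (\<Union>f \<in> active_faces k c. corners f)" for x y
    unfolding aztec_vertex_active(1) UN_iff Bex_def split_paired_Ex corners_iff by blast
  then show ?thesis by auto
qed

text \<open>This identifies the vertices that survive complementation: shuffling leads from size
  \<open>k + 1\<close> to size \<open>k\<close>.\<close>

lemma aztec_vertices_eq: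
  "aztec_vertices k c =
    {v. \<exists>f \<in> active_faces k c. \<exists>g \<in> active_faces k c. f \<noteq> g \<and> v \<in> corners f \<and> v \<in> corners g}"
proof -
  have "(x, y) \<notin> active_faces k c \<or> (x - 1, y) \<notin> active_faces k c"
    "(x, y) \<notin> active_faces k c \<or> (x, y - 1) \<notin> active_faces k c"
    "(x - 1, y - 1) \<notin> active_faces k c \<or> (x - 1, y) \<notin> active_faces k c"
    "(x - 1, y - 1) \<notin> active_faces k c \<or> (x, y - 1) \<notin> active_faces k c" for x y
    unfolding active_faces_def by auto
  then have "(x, y) \<in> {v. \<exists>f \<in> active_faces k c. \<exists>g \<in> active_faces k c.
      f \<noteq> g \<and> v \<in> corners f \<and> v \<in> corners g} \<longleftrightarrow> (x, y) \<in> aztec_vertices k c" for x y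
    unfolding aztec_vertex_active(2) mem_Collect_eq Bex_def split_paired_Ex corners_iff prod.inject
    by (smt (verit))
  then show ?thesis by (intro equalityI subrelI) (simp_all only:)
qed

lemma finite_all_faces: "finite (all_faces k c)"
proof -
  have "all_faces k c \<subseteq> {fst c - int k..fst c + int k} \<times> {snd c - int k..snd c + int k}"
    by (cases c) (auto simp: all_faces_def)
  then show ?thesis by (rule finite_subset) simp
qed

lemma all_faces_iff: "(x, y) \<in> all_faces k (i, j) \<longleftrightarrow> \<bar>x - i\<bar> + \<bar>y - j\<bar> \<le> int k"
  by (auto simp: all_faces_def)

lemma active_subset_all: "active_faces k c \<subseteq> all_faces k c"
  by (cases c) (auto simp: active_faces_def all_faces_iff)

lemma active_internal: "f \<in> active_faces k c \<Longrightarrow> f \<in> internal_faces (Suc k) c"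
  by (cases c) (auto simp: active_faces_def)

lemma active_arcs_disjoint:
  assumes "f \<in> active_faces k c" "g \<in> active_faces k c" "f \<noteq> g"
  shows "face_arcs f \<inter> face_arcs g = {}"
proof (rule ccontr)
  assume "face_arcs f \<inter> face_arcs g \<noteq> {}"
  then obtain u v where uv: "(u, v) \<in> face_arcs f" "(u, v) \<in> face_arcs g" by auto
  obtain s t s' t' where fg: "f = (s, t)" "g = (s', t')" by (metis surj_pair)
  have "even (s + t + s' + t')"
    using assms by (auto simp: fg active_faces_def)
  moreover have "adjacent u v" using uv(1) by (rule face_arcs_adjacent)
  then have "s = s' \<and> (t = t' \<or> t = t' + 1 \<or> t' = t + 1) \<or> t = t' \<and> (s = s' \<or> s = s' + 1 \<or> s' = s + 1)"
    unfolding adjacent_cases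
    by (elim exE insertE emptyE) (use uv in \<open>auto simp: fg face_arcs_iff\<close>)
  ultimately show False using assms(3) by (auto simp: fg)
qed

lemma active_corner_two:
  assumes "f \<in> active_faces k c" "g \<in> active_faces k c" "h \<in> active_faces k c"
    and "v \<in> corners f" "v \<in> corners g" "v \<in> corners h"
  shows "f = g \<or> f = h \<or> g = h"
proof -
  obtain x y where v: "v = (x, y)" by (cases v)
  have near: "f \<in> {(x, y), (x - 1, y - 1), (x - 1, y), (x, y - 1)}" if "v \<in> corners f" for f
    using that by (cases f) (auto simp: v)
  have par: "even (fst f + snd f + fst c + snd c + int k)" if "f \<in> active_faces k c" for f
    using that by (auto simp: active_faces_def)
  show ?thesis
  proof (cases "even (x + y + fst c + snd c + int k)")
    case True
    then have "f \<in> {(x, y), (x - 1, y - 1)}"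
      if "f \<in> active_faces k c" "v \<in> corners f" for f
      using near[OF that(2)] par[OF that(1)] by auto
    then show ?thesis using assms by blast
  next
    case False
    then have "f \<in> {(x - 1, y), (x, y - 1)}"
      if "f \<in> active_faces k c" "v \<in> corners f" for f
      using near[OF that(2)] par[OF that(1)] by auto
    then show ?thesis using assms by blast
  qed
qed

section \<open>The shuffling step for the partition function\<close>

definition face_factor :: "(arc \<Rightarrow> int) \<Rightarrow> (face \<Rightarrow> complex) \<Rightarrow> face \<Rightarrow> complex" where
  "face_factor \<phi> a = (\<lambda>(x, y).
     - of_int (\<phi> ((x + 1, y), (x + 1, y + 1)) * \<phi> ((x, y), (x, y + 1))) *
       dskp_den (a (x, y)) (a (x, y + 1)) (a (x + 1, y)) (a (x, y - 1)) (a (x - 1, y)))"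

text \<open>The step acts on the whole plane, so that it suits every centre; \<open>m\<close>
  selects the colour that is updated.\<close>

definition dskp_step :: "int \<Rightarrow> (face \<Rightarrow> complex) \<Rightarrow> (face \<Rightarrow> complex) \<Rightarrow> bool" where
  "dskp_step m a a' \<longleftrightarrow> (\<forall>x y. if even (x + y + m)
     then dskp (a (x, y)) (a (x, y + 1)) (a (x + 1, y)) (a (x, y - 1)) (a (x - 1, y)) (a' (x, y))
     else a' (x, y) = a (x, y))"

lemma dskp_step_even:
  assumes "dskp_step m a a'" "even (x + y + m)"
  shows "dskp (a (x, y)) (a (x, y + 1)) (a (x + 1, y)) (a (x, y - 1)) (a (x - 1, y)) (a' (x, y))"
  using assms(1)[unfolded dskp_step_def, THEN spec[of _ x], THEN spec[of _ y]] assms(2)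
  by (simp only: if_True)

lemma dskp_step_odd:
  assumes "dskp_step m a a'" "odd (x + y + m)"
  shows "a' (x, y) = a (x, y)"
  using assms(1)[unfolded dskp_step_def, THEN spec[of _ x], THEN spec[of _ y]] assms(2)
  by (simp only: if_False)

lemma dskp_step_inverse:
  assumes step: "dskp_step m a a'" and nz: "\<And>f. a f \<noteq> 0" "\<And>f. a' f \<noteq> 0"
  shows "dskp_step m (\<lambda>f. inverse (a f)) (\<lambda>f. inverse (a' f))"
  unfolding dskp_step_def
proof (intro allI)
  fix x y
  show "if even (x + y + m)
    then dskp (inverse (a (x, y))) (inverse (a (x, y + 1))) (inverse (a (x + 1, y)))
      (inverse (a (x, y - 1))) (inverse (a (x - 1, y))) (inverse (a' (x, y)))
    else inverse (a' (x, y)) = inverse (a (x, y))"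
    using dskp_inverse[OF dskp_step_even[OF step] nz(1) nz(1) nz(1) nz(1) nz(1) nz(2), of x y]
      dskp_step_odd[OF step, of x y]
    by (simp split: if_split)
qed

text \<open>The local move is made at all active faces at once, \<open>face_factor\<close> being the
  \<open>\<Delta>\<close> of \<open>face_complement\<close>. The vertex factor \<open>g\<close> is
  left open because the weights and their inverses use different ones.\<close>

lemma dimer_Z_step:
  assumes K: "kasteleyn (Suc k) (i, j) \<phi>" and step: "dskp_step m a a'"
    and m: "even (m + i + j + int k)"
    and g: "\<And>x y. even (x + y + m) \<Longrightarrow> \<exists>\<epsilon>. \<epsilon> * \<epsilon> = 1 \<and>
      g (x, y) * (a (x, y - 1) - a (x - 1, y)) = \<epsilon> \<and>
      g (x + 1, y) * (a (x, y - 1) - a (x + 1, y)) = \<epsilon> \<and>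
      g (x + 1, y + 1) * (a (x, y + 1) - a (x + 1, y)) = \<epsilon> \<and>
      g (x, y + 1) * (a (x, y + 1) - a (x - 1, y)) = \<epsilon>"
  shows "dimer_Z (Suc k) (i, j) a \<phi> =
    (\<Prod>f \<in> active_faces k (i, j). face_factor \<phi> a f) * (\<Prod>v \<in> aztec_vertices k (i, j). g v) *
      dimer_Z k (i, j) a' \<phi>"
proof -
  let ?c = "(i, j)" and ?I = "active_faces k (i, j)"
  have *: "dimer_Z (Suc k) ?c a \<phi> =
      matching_sum (\<Union>f \<in> ?I. face_arcs f) (arc_weight \<phi> a) (aztec_vertices (Suc k) ?c)"
    "dimer_Z k ?c a' \<phi> =
      matching_sum (\<Union>f \<in> ?I. face_arcs f) (arc_weight \<phi> a') (aztec_vertices k ?c)"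
    by (rule dimer_Z_eq_matching_sum; simp)+
  show ?thesis
    unfolding *
  proof (rule matching_sum_complement[where K = corners])
    show "finite ?I" by (rule finite_subset[OF active_subset_all finite_all_faces])
    show "finite (face_arcs f)" for f by (cases f) (simp add: face_arcs_eq cycle_arcs_def)
    show "finite (corners f)" for f by (cases f) simp
    show "fst e \<in> corners f \<and> snd e \<in> corners f" if "e \<in> face_arcs f" for f e
      using that by (auto simp: face_arcs_def simp del: corners.simps)
    show "matching_sum (face_arcs f) (arc_weight \<phi> a) S = face_factor \<phi> a f *
        (\<Prod>v \<in> corners f - S. g v) * matching_sum (face_arcs f) (arc_weight \<phi> a') (corners f - S)"
      if f: "f \<in> ?I" and S: "S \<subseteq> corners f" for f S
    proof -
      obtain x y where xy: "f = (x, y)" by (cases f)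
      have "even (x + y + i + j + int k)" using f by (simp add: xy active_faces_def)
      then have ev: "even (x + y + m)" using m by presburger
      then have D: "dskp (a (x, y)) (a (x, y + 1)) (a (x + 1, y)) (a (x, y - 1)) (a (x - 1, y)) (a' (x, y))"
        by (rule dskp_step_even[OF step])
      have "odd (x + (y + 1) + m)" "odd (x + 1 + y + m)" "odd (x + (y - 1) + m)" "odd (x - 1 + y + m)"
        using ev by presburger+
      then have in': "a' (x, y + 1) = a (x, y + 1)" "a' (x + 1, y) = a (x + 1, y)"
          "a' (x, y - 1) = a (x, y - 1)" "a' (x - 1, y) = a (x - 1, y)"
        by (auto intro: dskp_step_odd[OF step])
      obtain \<epsilon> where "\<epsilon> * \<epsilon> = 1"
        "g (x, y) * (a (x, y - 1) - a (x - 1, y)) = \<epsilon>"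
        "g (x + 1, y) * (a (x, y - 1) - a (x + 1, y)) = \<epsilon>"
        "g (x + 1, y + 1) * (a (x, y + 1) - a (x + 1, y)) = \<epsilon>"
        "g (x, y + 1) * (a (x, y + 1) - a (x - 1, y)) = \<epsilon>"
        using g[OF ev] by blast
      note \<epsilon> = this
      show ?thesis
        unfolding xy
        by (rule face_complement[OF K _ refl in' refl refl refl refl refl D \<epsilon>(2-5) \<epsilon>(1)])
          (use f S active_internal[of f k ?c] in \<open>auto simp: xy face_factor_def simp del: internal_faces.simps corners.simps\<close>)
    qed
    show "face_arcs f \<inter> face_arcs g = {}" if "f \<in> ?I" "g \<in> ?I" "f \<noteq> g" for f g
      using that by (rule active_arcs_disjoint)
    show "f = g \<or> f = h \<or> g = h" if "f \<in> ?I" "g \<in> ?I" "h \<in> ?I"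
      "v \<in> corners f" "v \<in> corners g" "v \<in> corners h" for f g h v
      using that by (rule active_corner_two)
  qed (rule aztec_vertices_Suc_eq aztec_vertices_eq)+
qed

text \<open>
  The two active faces at a vertex lie diagonally, and see the difference of the two other weights
  with opposite signs; the sign \<open>(-1)\<^sup>x\<close> compensates for this.
\<close>

definition gauge :: "int \<Rightarrow> (face \<Rightarrow> complex) \<Rightarrow> vertex \<Rightarrow> complex" where
  "gauge m a = (\<lambda>(x, y). (if even x then 1 else -1) /
     (if even (x + y + m) then a (x, y - 1) - a (x - 1, y) else a (x, y) - a (x - 1, y - 1)))"

text \<open>At the two corners with first coordinate \<open>x + 1\<close> the sign in
  \<open>gauge\<close> flips, and so does the order of the difference; all four corners therefore
  give the same sign.\<close>

lemma gauge_corners: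
  assumes step: "dskp_step m a a'" and ev: "even (x + y + m)"
  defines "\<epsilon> \<equiv> (if even x then 1 else -1)"
  shows "gauge m a (x, y) * (a (x, y - 1) - a (x - 1, y)) = \<epsilon>"
    "gauge m a (x + 1, y) * (a (x, y - 1) - a (x + 1, y)) = \<epsilon>"
    "gauge m a (x + 1, y + 1) * (a (x, y + 1) - a (x + 1, y)) = \<epsilon>"
    "gauge m a (x, y + 1) * (a (x, y + 1) - a (x - 1, y)) = \<epsilon>"
proof -
  have "dskp (a (x, y)) (a (x, y + 1)) (a (x + 1, y)) (a (x, y - 1)) (a (x - 1, y)) (a' (x, y))"
    by (rule dskp_step_even[OF step ev])
  then have ne: "a (x, y + 1) \<noteq> a (x + 1, y)" "a (x, y + 1) \<noteq> a (x - 1, y)"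
      "a (x, y - 1) \<noteq> a (x + 1, y)" "a (x, y - 1) \<noteq> a (x - 1, y)"
    by (auto simp: dskp_def)
  have par: "odd (x + 1 + y + m)" "even (x + 1 + (y + 1) + m)" "odd (x + (y + 1) + m)"
    using ev by presburger+
  show "gauge m a (x, y) * (a (x, y - 1) - a (x - 1, y)) = \<epsilon>"
    using ne ev by (simp add: gauge_def \<epsilon>_def)
  have "gauge m a (x + 1, y) = (if even (x + 1) then 1 else -1) / (a (x + 1, y) - a (x, y - 1))"
    using par(1) unfolding gauge_def prod.case by (simp only: if_False) simp
  then show "gauge m a (x + 1, y) * (a (x, y - 1) - a (x + 1, y)) = \<epsilon>"
    using ne(3) by (simp add: \<epsilon>_def field_simps)
  have "gauge m a (x + 1, y + 1) = (if even (x + 1) then 1 else -1) / (a (x + 1, y) - a (x, y + 1))"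
    using par(2) unfolding gauge_def prod.case by (simp only: if_True) simp
  then show "gauge m a (x + 1, y + 1) * (a (x, y + 1) - a (x + 1, y)) = \<epsilon>"
    using ne(1) by (simp add: \<epsilon>_def field_simps)
  have "gauge m a (x, y + 1) = (if even x then 1 else -1) / (a (x, y + 1) - a (x - 1, y))"
    using par(3) unfolding gauge_def prod.case by (simp only: if_False) simp
  then show "gauge m a (x, y + 1) * (a (x, y + 1) - a (x - 1, y)) = \<epsilon>"
    using ne(2) by (simp add: \<epsilon>_def)
qed

text \<open>Products over different index sets become products over one set \<open>B\<close>, where
  they can be compared factor by factor.\<close>

lemma prod_image_restrict:
  assumes "inj_on T V" "T ` V \<subseteq> B" "finite B"
  shows "(\<Prod>v \<in> V. r (T v)) = (\<Prod>h \<in> B. if h \<in> T ` V then r h else (1::complex))"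
proof -
  have "(\<Prod>v \<in> V. r (T v)) = (\<Prod>h \<in> T ` V. r h)"
    by (simp add: prod.reindex[OF assms(1)])
  also have "\<dots> = (\<Prod>h \<in> B. if h \<in> T ` V then r h else 1)"
    using assms(2,3) by (intro prod.mono_neutral_cong_left) auto
  finally show ?thesis .
qed

section \<open>Invariance of the ratio function\<close>

lemma finite_active: "finite (active_faces k c)"
  by (rule finite_subset[OF active_subset_all finite_all_faces])

lemma finite_aztec_vertices: "finite (aztec_vertices k c)"
proof -
  have "finite (corners f)" for f by (cases f) simp
  then have "finite (aztec_vertices (Suc k) c)"
    using finite_active[of k c] by (simp add: aztec_vertices_Suc_eq)
  then show ?thesis by (rule finite_subset[OF aztec_vertices_mono])
qed

definition inactive_part :: "int \<Rightarrow> (face \<Rightarrow> complex) \<Rightarrow> face \<Rightarrow> complex" where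
  "inactive_part m a = (\<lambda>(x, y). if even (x + y + m) then 1 else a (x, y))"

text \<open>The product of the two inactive weights at the vertex: the factor that
  \<open>gauge\<close> acquires when the weights are inverted, up to a common sign. Replacing active
  weights by 1 avoids a case distinction on the colour of the vertex.\<close>

definition vertex_part :: "int \<Rightarrow> (face \<Rightarrow> complex) \<Rightarrow> vertex \<Rightarrow> complex" where
  "vertex_part m a = (\<lambda>(x, y). inactive_part m a (x, y) * inactive_part m a (x - 1, y) *
     inactive_part m a (x, y - 1) * inactive_part m a (x - 1, y - 1))"

text \<open>Steps in opposite directions cannot both lead from distance \<open>K + 1\<close> to
  distance \<open>K\<close>, and some step towards the centre does.\<close>

lemma around_face:
  fixes x y i j K :: int
  assumes "\<bar>x - i\<bar> + \<bar>y - j\<bar> = K + 1"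
  shows "\<not> (\<bar>x + 1 - i\<bar> + \<bar>y - j\<bar> \<le> K \<and> \<bar>x - 1 - i\<bar> + \<bar>y - j\<bar> \<le> K)"
    "\<not> (\<bar>x - i\<bar> + \<bar>y + 1 - j\<bar> \<le> K \<and> \<bar>x - i\<bar> + \<bar>y - 1 - j\<bar> \<le> K)"
    "K \<ge> 0 \<Longrightarrow> \<bar>x + 1 - i\<bar> + \<bar>y - j\<bar> \<le> K \<or> \<bar>x - 1 - i\<bar> + \<bar>y - j\<bar> \<le> K \<or>
      \<bar>x - i\<bar> + \<bar>y + 1 - j\<bar> \<le> K \<or> \<bar>x - i\<bar> + \<bar>y - 1 - j\<bar> \<le> K"
  using assms by (auto simp: abs_if split: if_splits)

text \<open>An active face contributes its old and its new weight once on each side. An inactive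
  face inside has exponent 1 + 4 on both sides. An inactive face on the rim has either one active
  neighbour and no corner in \<open>V\<close>, or two active neighbours and one corner in
  \<open>V\<close>; the exponents are 1 + 0 = 1 and 1 + 1 = 2.\<close>

lemma face_weight_count:
  assumes m: "even (m + i + j + int k)" and odd: "\<And>x y. odd (x + y + m) \<Longrightarrow> a' (x, y) = a (x, y)"
    and h: "(x, y) \<in> all_faces (Suc k) (i, j)"
  defines "A \<equiv> active_faces k (i, j)" and "V \<equiv> aztec_vertices k (i, j)"
    and "r \<equiv> inactive_part m a"
  shows "a (x, y) * (if (x, y) \<in> A then a' (x, y) else 1) *
      ((if (x, y) \<in> V then r (x, y) else 1) * (if (x + 1, y) \<in> V then r (x, y) else 1) *
       (if (x, y + 1) \<in> V then r (x, y) else 1) * (if (x + 1, y + 1) \<in> V then r (x, y) else 1)) =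
    (if (x, y) \<in> all_faces k (i, j) then a' (x, y) else 1) *
      ((if (x, y) \<in> A then a (x, y) else 1) *
       (if (x, y - 1) \<in> A then a (x, y) else 1) * (if (x - 1, y) \<in> A then a (x, y) else 1) *
       (if (x, y + 1) \<in> A then a (x, y) else 1) * (if (x + 1, y) \<in> A then a (x, y) else 1))"
proof -
  define D where "D = \<bar>x - i\<bar> + \<bar>y - j\<bar>"
  have D: "D \<le> int k + 1" using h by (simp add: all_faces_iff D_def)
  have evD: "even (D + m + i + j) \<longleftrightarrow> even (x + y + m)"
    by (auto simp: D_def)
  have A: "(s, t) \<in> A \<longleftrightarrow> \<bar>s - i\<bar> + \<bar>t - j\<bar> \<le> int k \<and> even (s + t + m)" for s t
    using m by (auto simp: A_def active_faces_def)
  show ?thesis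
  proof (cases "even (x + y + m)")
    case True
    then have "even (D + int k)" using evD m by presburger
    then have "D \<le> int k" using D by presburger
    then have "(x, y) \<in> A" "(x, y) \<in> all_faces k (i, j)"
      using True by (simp_all add: A all_faces_iff D_def)
    moreover have "(x, y - 1) \<notin> A" "(x - 1, y) \<notin> A" "(x, y + 1) \<notin> A" "(x + 1, y) \<notin> A"
      using True unfolding A by auto
    moreover have "r (x, y) = 1" using True by (simp add: r_def inactive_part_def)
    ultimately show ?thesis by simp
  next
    case False
    define N E S W where b: "N = ((x, y + 1) \<in> A)" "E = ((x + 1, y) \<in> A)"
      "S = ((x, y - 1) \<in> A)" "W = ((x - 1, y) \<in> A)"
    have nA: "(x, y) \<notin> A" "(x - 1, y - 1) \<notin> A" "(x + 1, y + 1) \<notin> A" "(x - 1, y + 1) \<notin> A" "(x + 1, y - 1) \<notin> A"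
      using False by (auto simp: A)
    have ne: "N \<longleftrightarrow> \<bar>x - i\<bar> + \<bar>y + 1 - j\<bar> \<le> int k" "E \<longleftrightarrow> \<bar>x + 1 - i\<bar> + \<bar>y - j\<bar> \<le> int k"
      "S \<longleftrightarrow> \<bar>x - i\<bar> + \<bar>y - 1 - j\<bar> \<le> int k" "W \<longleftrightarrow> \<bar>x - 1 - i\<bar> + \<bar>y - j\<bar> \<le> int k"
      using False by (auto simp: A b)
    have V: "(x, y) \<in> V \<longleftrightarrow> W \<and> S" "(x + 1, y) \<in> V \<longleftrightarrow> E \<and> S" "(x, y + 1) \<in> V \<longleftrightarrow> W \<and> N"
      "(x + 1, y + 1) \<in> V \<longleftrightarrow> N \<and> E"
      unfolding V_def aztec_vertex_active(2) A_def[symmetric] using nA by (auto simp: b)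
    have r: "r (x, y) = a (x, y)" "a' (x, y) = a (x, y)" using False odd by (auto simp: r_def inactive_part_def)
    have "odd (D + int k)" using False evD m by presburger
    then have "D \<noteq> int k" by auto
    then have "D = int k + 1 \<or> D \<le> int k - 1" using D by linarith
    then show ?thesis
    proof
      assume 1: "D = int k + 1"
      then have "(x, y) \<notin> all_faces k (i, j)" by (simp add: all_faces_iff D_def)
      moreover have "\<not> (E \<and> W)" "\<not> (N \<and> S)" "E \<or> W \<or> N \<or> S"
        using around_face[of x i y j "int k"] 1 unfolding ne D_def by auto
      ultimately show ?thesis
        using nA unfolding V r b[symmetric] by auto
    next
      assume "D \<le> int k - 1"
      then have "N" "E" "S" "W" "(x, y) \<in> all_faces k (i, j)"
        unfolding ne all_faces_iff D_def by linarith+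
      then show ?thesis
        using nA unfolding V r b[symmetric] by simp
    qed
  qed
qed

text \<open>All products are reindexed over the faces of the larger diamond, after which the
  identity is \<open>face_weight_count\<close> at each face. It matches the prefactors of
  \<open>ratio_Y\<close> for the two sizes.\<close>

lemma weight_product_step:
  assumes m: "even (m + i + j + int k)" and odd: "\<And>x y. odd (x + y + m) \<Longrightarrow> a' (x, y) = a (x, y)"
  defines "A \<equiv> active_faces k (i, j)"
  shows "(\<Prod>f \<in> all_faces (Suc k) (i, j). a f) * (\<Prod>f \<in> A. a' f) *
      (\<Prod>v \<in> aztec_vertices k (i, j). vertex_part m a v) =
    (\<Prod>f \<in> all_faces k (i, j). a' f) *
      (\<Prod>(x, y) \<in> A. a (x, y) * a (x, y + 1) * a (x + 1, y) * a (x, y - 1) * a (x - 1, y))"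
proof -
  define B where "B = all_faces (Suc k) (i, j)"
  define V where "V = aztec_vertices k (i, j)"
  define r where "r = inactive_part m a"
  have finB: "finite B" by (simp add: B_def finite_all_faces)
  have AB: "(x + s, y + t) \<in> B" if "(x, y) \<in> A" "\<bar>s\<bar> + \<bar>t\<bar> \<le> 1" for x y s t
  proof -
    have "\<bar>x + s - i\<bar> \<le> \<bar>x - i\<bar> + \<bar>s\<bar>" "\<bar>y + t - j\<bar> \<le> \<bar>y - j\<bar> + \<bar>t\<bar>" by arith+
    moreover have "\<bar>x - i\<bar> + \<bar>y - j\<bar> \<le> int k" using that(1) by (simp add: A_def active_faces_def)
    ultimately have "\<bar>x + s - i\<bar> + \<bar>y + t - j\<bar> \<le> int (Suc k)" using that(2) by simp
    then show ?thesis by (simp only: B_def all_faces_iff)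
  qed
  have VB: "(x + s, y + t) \<in> B" if "(x, y) \<in> V" "s \<in> {0, -1}" "t \<in> {0, -1}" for x y s t
  proof -
    have "\<bar>2 * (x - i) - 1\<bar> + \<bar>2 * (y - j) - 1\<bar> \<le> 2 * int k"
      using that(1) by (simp add: V_def aztec_vertices_iff)
    then show ?thesis using that(2,3) by (auto simp: B_def all_faces_iff)
  qed
  have shift: "(\<Prod>(x, y) \<in> U. b (x + s, y + t)) =
      (\<Prod>(x, y) \<in> B. if (x - s, y - t) \<in> U then b (x, y) else 1)"
    if "\<And>x y. (x, y) \<in> U \<Longrightarrow> (x + s, y + t) \<in> B" for U s t and b :: "face \<Rightarrow> complex"
  proof -
    define T where "T = (\<lambda>(x, y). (x + s, y + t))"
    have "inj_on T U" "T ` U \<subseteq> B" using that by (auto simp: T_def inj_on_def)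
    then have "(\<Prod>v \<in> U. b (T v)) = (\<Prod>h \<in> B. if h \<in> T ` U then b h else 1)"
      using finB by (rule prod_image_restrict)
    moreover have mem: "(x, y) \<in> T ` U \<longleftrightarrow> (x - s, y - t) \<in> U" for x y
      by (force simp: T_def image_iff)
    have "(\<Prod>h \<in> B. if h \<in> T ` U then b h else 1) =
        (\<Prod>(x, y) \<in> B. if (x - s, y - t) \<in> U then b (x, y) else 1)"
      by (rule prod.cong[OF refl]) (simp only: split_paired_all prod.case mem)
    ultimately show ?thesis by (simp add: T_def case_prod_unfold)
  qed
  have A: "(\<Prod>(x, y) \<in> A. b (x + s, y + t)) =
      (\<Prod>(x, y) \<in> B. if (x - s, y - t) \<in> A then b (x, y) else 1)"
    if "\<bar>s\<bar> + \<bar>t\<bar> \<le> 1" for s t and b :: "face \<Rightarrow> complex"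
    using shift[of A s t b] AB that by blast
  have Vs: "(\<Prod>(x, y) \<in> V. b (x + s, y + t)) =
      (\<Prod>(x, y) \<in> B. if (x - s, y - t) \<in> V then b (x, y) else 1)"
    if "s \<in> {0, -1}" "t \<in> {0, -1}" for s t and b :: "face \<Rightarrow> complex"
    using shift[of V s t b] VB that by blast
  have F: "(\<Prod>f \<in> all_faces k (i, j). a' f) =
      (\<Prod>(x, y) \<in> B. if (x, y) \<in> all_faces k (i, j) then a' (x, y) else 1)"
    using shift[of "all_faces k (i, j)" 0 0 a'] by (simp add: B_def all_faces_iff case_prod_unfold)
  have "(\<Prod>f \<in> B. a f) * (\<Prod>f \<in> A. a' f) * (\<Prod>v \<in> V. vertex_part m a v) =
      (\<Prod>(x, y) \<in> B. a (x, y) * (if (x, y) \<in> A then a' (x, y) else 1) *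
      ((if (x, y) \<in> V then r (x, y) else 1) * (if (x + 1, y) \<in> V then r (x, y) else 1) *
       (if (x, y + 1) \<in> V then r (x, y) else 1) * (if (x + 1, y + 1) \<in> V then r (x, y) else 1)))"
    using A[of 0 0 a'] Vs[of 0 0 r] Vs[of "-1" 0 r] Vs[of 0 "-1" r] Vs[of "-1" "-1" r]
    by (simp add: vertex_part_def r_def[symmetric] case_prod_unfold prod.distrib)
  also have "\<dots> = (\<Prod>(x, y) \<in> B. (if (x, y) \<in> all_faces k (i, j) then a' (x, y) else 1) *
      ((if (x, y) \<in> A then a (x, y) else 1) *
       (if (x, y - 1) \<in> A then a (x, y) else 1) * (if (x - 1, y) \<in> A then a (x, y) else 1) *
       (if (x, y + 1) \<in> A then a (x, y) else 1) * (if (x + 1, y) \<in> A then a (x, y) else 1)))"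
    by (rule prod.cong[OF refl])
      (clarify, unfold A_def V_def r_def prod.case, rule face_weight_count[where a = a and a' = a', OF m odd],
        simp_all add: B_def)
  also have "\<dots> = (\<Prod>f \<in> all_faces k (i, j). a' f) *
      (\<Prod>(x, y) \<in> A. a (x, y) * a (x, y + 1) * a (x + 1, y) * a (x, y - 1) * a (x - 1, y))"
    using A[of 0 0 a] A[of 0 1 a] A[of 1 0 a] A[of 0 "-1" a] A[of "-1" 0 a] F
    by (simp add: case_prod_unfold prod.distrib)
  finally show ?thesis by (simp add: B_def V_def)
qed

text \<open>Shuffling the weights and their inverses produces the same factor \<open>C\<close> up to
  monomials in the weights. \<open>C\<close> cancels in the quotient, and by
  \<open>weight_product_step\<close> the monomials turn the prefactor of size \<open>k + 1\<close>
  into that of size \<open>k\<close>.\<close>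

lemma ratio_Y_step:
  assumes K: "kasteleyn (Suc k) (i, j) \<phi>" and step: "dskp_step m a a'"
    and m: "even (m + i + j + int k)"
    and nz: "\<And>f. a f \<noteq> 0" "\<And>f. a' f \<noteq> 0"
  shows "dimer_Z (Suc k) (i, j) a \<phi> \<noteq> 0 \<longleftrightarrow> dimer_Z k (i, j) a' \<phi> \<noteq> 0"
    and "ratio_Y (Suc k) (i, j) a \<phi> = ratio_Y k (i, j) a' \<phi>"
proof -
  let ?A = "active_faces k (i, j)" and ?V = "aztec_vertices k (i, j)"
  let ?ia = "\<lambda>f. inverse (a f)" and ?ia' = "\<lambda>f. inverse (a' f)"
  define P where "P = (\<lambda>(x, y). a (x, y) * a (x, y + 1) * a (x + 1, y) * a (x, y - 1) * a (x - 1, y))"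
  define C where "C = (\<Prod>f \<in> ?A. face_factor \<phi> a f) * (\<Prod>v \<in> ?V. gauge m a v)"
  have evA: "even (x + y + m)" if "(x, y) \<in> ?A" for x y
    using that m by (auto simp: active_faces_def)
  have "dimer_Z (Suc k) (i, j) a \<phi> = C * dimer_Z k (i, j) a' \<phi>"
    unfolding C_def
  proof (rule dimer_Z_step[OF K step m])
    fix x y :: int assume ev: "even (x + y + m)"
    show "\<exists>\<epsilon>. \<epsilon> * \<epsilon> = 1 \<and>
      gauge m a (x, y) * (a (x, y - 1) - a (x - 1, y)) = \<epsilon> \<and>
      gauge m a (x + 1, y) * (a (x, y - 1) - a (x + 1, y)) = \<epsilon> \<and>
      gauge m a (x + 1, y + 1) * (a (x, y + 1) - a (x + 1, y)) = \<epsilon> \<and>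
      gauge m a (x, y + 1) * (a (x, y + 1) - a (x - 1, y)) = \<epsilon>"
      using gauge_corners[OF step ev] by (intro exI[of _ "if even x then 1 else -1"]) simp
  qed
  note Z = this
  \<comment> \<open>The factor \<open>vertex_part\<close> clears the denominators of the differences
    of inverse weights; the common sign at the corners becomes its negative.\<close>
  have "dimer_Z (Suc k) (i, j) ?ia \<phi> = (\<Prod>f \<in> ?A. face_factor \<phi> ?ia f) *
      (\<Prod>v \<in> ?V. gauge m a v * vertex_part m a v) * dimer_Z k (i, j) ?ia' \<phi>"
  proof (rule dimer_Z_step[OF K dskp_step_inverse[OF step nz] m])
    fix x y :: int assume ev: "even (x + y + m)"
    then have par: "odd (x + (y + 1) + m)" "odd (x + 1 + y + m)" "odd (x + (y - 1) + m)"
      "odd (x - 1 + y + m)" "even (x + 1 + (y + 1) + m)" "even (x + 1 + (y - 1) + m)"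
      "even (x - 1 + (y + 1) + m)" "even (x - 1 + (y - 1) + m)"
      by presburger+
    have vp: "vertex_part m a (x, y) = a (x - 1, y) * a (x, y - 1)"
      "vertex_part m a (x + 1, y) = a (x + 1, y) * a (x, y - 1)"
      "vertex_part m a (x + 1, y + 1) = a (x, y + 1) * a (x + 1, y)"
      "vertex_part m a (x, y + 1) = a (x, y + 1) * a (x - 1, y)"
      unfolding vertex_part_def inactive_part_def prod.case
        add_diff_cancel_right' diff_add_cancel
      using par ev by (simp_all only: if_True if_False not_False_eq_True mult_1_left mult_1_right)
    have flip: "g * (b * c) * (inverse c - inverse b) = g * (b - c)" if "b \<noteq> 0" "c \<noteq> 0" for g b c :: complex
      using that by (simp add: field_simps)
    have flip': "g * (b * c) * (inverse b - inverse c) = - (g * (b - c))" if "b \<noteq> 0" "c \<noteq> 0" for g b c :: complex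
      using that by (simp add: field_simps)
    let ?\<epsilon> = "if even x then 1 else -1 :: complex"
    have gc: "gauge m a (x, y) * (a (x - 1, y) - a (x, y - 1)) = - ?\<epsilon>"
      "gauge m a (x + 1, y) * (a (x + 1, y) - a (x, y - 1)) = - ?\<epsilon>"
      "gauge m a (x + 1, y + 1) * (a (x, y + 1) - a (x + 1, y)) = ?\<epsilon>"
      "gauge m a (x, y + 1) * (a (x, y + 1) - a (x - 1, y)) = ?\<epsilon>"
      unfolding minus_diff_eq[of "a (x, y - 1)", symmetric] mult_minus_right gauge_corners[OF step ev]
      by (rule refl)+
    show "\<exists>\<epsilon>. \<epsilon> * \<epsilon> = 1 \<and>
      gauge m a (x, y) * vertex_part m a (x, y) * (?ia (x, y - 1) - ?ia (x - 1, y)) = \<epsilon> \<and>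
      gauge m a (x + 1, y) * vertex_part m a (x + 1, y) * (?ia (x, y - 1) - ?ia (x + 1, y)) = \<epsilon> \<and>
      gauge m a (x + 1, y + 1) * vertex_part m a (x + 1, y + 1) * (?ia (x, y + 1) - ?ia (x + 1, y)) = \<epsilon> \<and>
      gauge m a (x, y + 1) * vertex_part m a (x, y + 1) * (?ia (x, y + 1) - ?ia (x - 1, y)) = \<epsilon>"
      unfolding vp flip[OF nz(1) nz(1)] flip'[OF nz(1) nz(1)] gc
      by (intro exI[of _ "- ?\<epsilon>"]) simp
  qed
  also have "(\<Prod>f \<in> ?A. face_factor \<phi> ?ia f) = (\<Prod>f \<in> ?A. face_factor \<phi> a f * (a' f / P f))"
  proof (rule prod.cong[OF refl], clarify)
    fix x y assume "(x, y) \<in> ?A"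
    from dskp_den_inverse[OF dskp_step_even[OF step evA[OF this]] nz(1) nz(1) nz(1) nz(1) nz(1)]
    show "face_factor \<phi> ?ia (x, y) = face_factor \<phi> a (x, y) * (a' (x, y) / P (x, y))"
      by (simp add: face_factor_def P_def)
  qed
  also have "\<dots> * (\<Prod>v \<in> ?V. gauge m a v * vertex_part m a v) =
      C * ((\<Prod>f \<in> ?A. a' f) / (\<Prod>f \<in> ?A. P f) * (\<Prod>v \<in> ?V. vertex_part m a v))"
    by (simp add: C_def prod.distrib prod_dividef)
  finally have Z': "dimer_Z (Suc k) (i, j) ?ia \<phi> =
      C * ((\<Prod>f \<in> ?A. a' f) / (\<Prod>f \<in> ?A. P f) * (\<Prod>v \<in> ?V. vertex_part m a v)) *
      dimer_Z k (i, j) ?ia' \<phi>" .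
  \<comment> \<open>\<open>C\<close> is nonzero: the denominators do not vanish, and each gauge
    factor times a difference is plus or minus 1.\<close>
  have "face_factor \<phi> a f \<noteq> 0" if f: "f \<in> ?A" for f
  proof -
    obtain x y where xy: "f = (x, y)" by (cases f)
    have "(x, y) \<in> internal_faces (Suc k) (i, j)" using active_internal[OF f] by (simp add: xy)
    note kf = kasteleyn_face(1)[OF K this]
    have "\<phi> ((x + 1, y), (x + 1, y + 1)) \<noteq> 0" "\<phi> ((x, y), (x, y + 1)) \<noteq> 0"
      using kf[of "(x + 1, y)" "(x + 1, y + 1)"] kf[of "(x, y)" "(x, y + 1)"]
      by (auto simp: face_arcs_eq cycle_arcs_def)
    then show ?thesis
      using dskp_step_even[OF step evA[OF f[unfolded xy]]]
      by (simp add: xy face_factor_def dskp_def)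
  qed
  moreover have "gauge m a v \<noteq> 0" if v: "v \<in> ?V" for v
  proof -
    obtain x y where xy: "v = (x, y)" by (cases v)
    show ?thesis
    proof (cases "even (x + y + m)")
      case True
      then show ?thesis using gauge_corners(1)[OF step True] by (auto simp: xy split: if_splits)
    next
      case False
      then have "even (x + (y - 1) + m)" by presburger
      from gauge_corners(4)[OF step this] show ?thesis by (auto simp: xy split: if_splits)
    qed
  qed
  ultimately have C: "C \<noteq> 0"
    using finite_active finite_aztec_vertices by (simp add: C_def)
  with Z show "dimer_Z (Suc k) (i, j) a \<phi> \<noteq> 0 \<longleftrightarrow> dimer_Z k (i, j) a' \<phi> \<noteq> 0" by simp
  have "(\<Prod>f \<in> ?A. P f) \<noteq> 0"
    using nz finite_active by (auto simp: P_def)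
  then have count: "(\<Prod>f \<in> all_faces (Suc k) (i, j). a f) *
      ((\<Prod>f \<in> ?A. a' f) / (\<Prod>f \<in> ?A. P f) * (\<Prod>v \<in> ?V. vertex_part m a v)) =
      (\<Prod>f \<in> all_faces k (i, j). a' f)"
    using weight_product_step[where a = a and a' = a', OF m dskp_step_odd[OF step], folded P_def]
    by (simp add: field_simps)
  have "ratio_Y (Suc k) (i, j) a \<phi> = (\<Prod>f \<in> all_faces (Suc k) (i, j). a f) *
      ((\<Prod>f \<in> ?A. a' f) / (\<Prod>f \<in> ?A. P f) * (\<Prod>v \<in> ?V. vertex_part m a v)) *
      (dimer_Z k (i, j) ?ia' \<phi> / dimer_Z k (i, j) a' \<phi>)"
    unfolding ratio_Y_def Z Z' using C by simp
  then show "ratio_Y (Suc k) (i, j) a \<phi> = ratio_Y k (i, j) a' \<phi>"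
    unfolding count ratio_Y_def .
qed

section \<open>Iteration down to size 0\<close>

lemma kasteleyn_Suc:
  assumes "kasteleyn (Suc k) c \<phi>"
  shows "kasteleyn k c \<phi>"
proof -
  have "internal_faces k c \<subseteq> internal_faces (Suc k) c" by (cases c) auto
  then show ?thesis using assms unfolding kasteleyn_def aztec_arcs_def by blast
qed

text \<open>A staircase of initial data: faces of the colour of \<open>l\<close> carry time
  \<open>l\<close>, the others time \<open>l + 1\<close>. A step moves the former to time
  \<open>l + 2\<close>.\<close>

definition layer :: "(nat \<Rightarrow> face \<Rightarrow> complex) \<Rightarrow> nat \<Rightarrow> face \<Rightarrow> complex" where
  "layer X l = (\<lambda>(x, y). X (if even (x + y + int l) then l else Suc l) (x, y))"

text \<open>The relation couples only points with the same parity of \<open>x + y + l\<close>, and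
  layers use the even ones. Values are nonzero so that they can be inverted.\<close>

definition dskp_solution :: "(nat \<Rightarrow> face \<Rightarrow> complex) \<Rightarrow> bool" where
  "dskp_solution X \<longleftrightarrow> (\<forall>l f. X l f \<noteq> 0) \<and>
     (\<forall>l x y. dskp (X l (x, y)) (X (Suc l) (x, y + 1)) (X (Suc l) (x + 1, y))
       (X (Suc l) (x, y - 1)) (X (Suc l) (x - 1, y)) (X (Suc (Suc l)) (x, y)))"

lemma dskp_step_layer:
  assumes "dskp_solution X"
  shows "dskp_step (int l) (layer X l) (layer X (Suc l))"
  unfolding dskp_step_def
proof (intro allI)
  fix x y :: int
  show "if even (x + y + int l)
    then dskp (layer X l (x, y)) (layer X l (x, y + 1)) (layer X l (x + 1, y)) (layer X l (x, y - 1))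
      (layer X l (x - 1, y)) (layer X (Suc l) (x, y))
    else layer X (Suc l) (x, y) = layer X l (x, y)"
  proof (cases "even (x + y + int l)")
    case True
    then have "odd (x + (y + 1) + int l)" "odd (x + 1 + y + int l)" "odd (x + (y - 1) + int l)"
      "odd (x - 1 + y + int l)" "odd (x + y + int (Suc l))"
      by auto
    then show ?thesis
      using True assms unfolding layer_def prod.case dskp_solution_def by (simp only: if_True if_False)
  next
    case False
    then have "even (x + y + int (Suc l))" by auto
    then show ?thesis
      using False unfolding layer_def prod.case by (simp only: if_True if_False)
  qed
qed

lemma dimer_Z_0: "dimer_Z 0 c a \<phi> = 1"
proof -
  have "oriented_dimers 0 c = {{}}"
    by (cases c) (auto simp: oriented_dimers_def aztec_arcs_def aztec_vertices_def)
  then show ?thesis by (simp add: dimer_Z_def)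
qed

lemma ratio_Y_0: "ratio_Y 0 c a \<phi> = a c"
proof -
  have "all_faces 0 c = {c}" by (cases c) (auto simp: all_faces_def)
  then show ?thesis by (simp add: ratio_Y_def dimer_Z_0)
qed

text \<open>Each step lowers the size and raises the layer by one, so \<open>l + k\<close> is
  preserved. At size 0 the parity condition puts the centre on the later time of the layer, whence
  the \<open>Suc\<close>.\<close>

lemma ratio_Y_solution:
  assumes X: "dskp_solution X"
  shows "kasteleyn k (i, j) \<phi> \<Longrightarrow> odd (i + j + int l + int k) \<Longrightarrow>
    dimer_Z k (i, j) (layer X l) \<phi> \<noteq> 0 \<and> ratio_Y k (i, j) (layer X l) \<phi> = X (Suc (l + k)) (i, j)"
proof (induction k arbitrary: l)
  case 0
  then show ?case by (simp add: dimer_Z_0 ratio_Y_0 layer_def)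
next
  case (Suc k)
  have nz: "layer X l f \<noteq> 0" for l f
    using X by (cases f) (simp add: layer_def dskp_solution_def)
  have m: "even (int l + i + j + int k)" using Suc.prems(2) by auto
  have "odd (i + j + int (Suc l) + int k)" using Suc.prems(2) by auto
  from Suc.IH[OF kasteleyn_Suc[OF Suc.prems(1)] this]
  show ?case
    using ratio_Y_step[OF Suc.prems(1) dskp_step_layer[OF X] m nz nz] by simp
qed

section \<open>Generic solutions in homogeneous coordinates\<close>

definition wedge :: "complex \<times> complex \<Rightarrow> complex \<times> complex \<Rightarrow> complex" where
  "wedge v w = fst v * snd w - fst w * snd v"

text \<open>The fraction that gives \<open>u\<close> in \<open>dskp\<close>, in homogeneous
  coordinates. It is linear in each of the five vectors and involves no division, so it also makes
  sense at infinity and for \<open>n = s\<close>.\<close>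

definition hstep :: "complex \<times> complex \<Rightarrow> complex \<times> complex \<Rightarrow> complex \<times> complex \<Rightarrow>
    complex \<times> complex \<Rightarrow> complex \<times> complex \<Rightarrow> complex \<times> complex" where
  "hstep d n e s w =
     (wedge d n * wedge s e * fst w - wedge n w * wedge e d * fst s,
      wedge d n * wedge s e * snd w - wedge n w * wedge e d * snd s)"

fun hsol :: "(face \<Rightarrow> complex) \<Rightarrow> nat \<Rightarrow> face \<Rightarrow> complex \<times> complex" where
  "hsol a 0 f = (a f, 1)"
| "hsol a (Suc 0) f = (a f, 1)"
| "hsol a (Suc (Suc l)) (x, y) = hstep (hsol a l (x, y)) (hsol a (Suc l) (x, y + 1))
     (hsol a (Suc l) (x + 1, y)) (hsol a (Suc l) (x, y - 1)) (hsol a (Suc l) (x - 1, y))"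

text \<open>A single polynomial condition: the value is neither 0 nor infinite and differs from two
  of its diagonal neighbours. Imposed everywhere it covers all four diagonal directions, hence the
  inequalities in \<open>dskp\<close>.\<close>

definition nondegeneracy :: "(face \<Rightarrow> complex) \<Rightarrow> nat \<Rightarrow> face \<Rightarrow> complex" where
  "nondegeneracy a l = (\<lambda>(x, y). fst (hsol a l (x, y)) * snd (hsol a l (x, y)) *
     wedge (hsol a l (x, y)) (hsol a l (x + 1, y + 1)) *
     wedge (hsol a l (x, y)) (hsol a l (x - 1, y + 1)))"

lemma dskp_hstep:
  fixes d n e s w :: "complex \<times> complex"
  defines "q \<equiv> \<lambda>v. fst v / snd v"
  assumes nz: "snd d \<noteq> 0" "snd n \<noteq> 0" "snd e \<noteq> 0" "snd s \<noteq> 0" "snd w \<noteq> 0" "snd (hstep d n e s w) \<noteq> 0"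
    and ne: "wedge n e \<noteq> 0" "wedge n w \<noteq> 0" "wedge s e \<noteq> 0" "wedge s w \<noteq> 0"
  shows "dskp (q d) (q n) (q e) (q s) (q w) (q (hstep d n e s w))"
proof -
  have wedge: "wedge v v' = snd v * snd v' * (q v - q v')" if "snd v \<noteq> 0" "snd v' \<noteq> 0" for v v'
    using that by (simp add: wedge_def q_def field_simps)
  have q: "fst v = snd v * q v" if "snd v \<noteq> 0" for v
    using that by (simp add: q_def)
  let ?c = "snd d * snd n * snd e * snd s * snd w"
  have "snd (hstep d n e s w) = ?c * dskp_den (q d) (q n) (q e) (q s) (q w)"
    unfolding hstep_def snd_conv using nz(1-5) by (simp add: wedge dskp_den_def algebra_simps)
  moreover have "fst (hstep d n e s w) =
      ?c * ((q d - q n) * (q s - q e) * q w - (q n - q w) * (q e - q d) * q s)"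
    unfolding hstep_def fst_conv using nz(1-5) by (simp add: wedge q algebra_simps)
  moreover have "?c \<noteq> 0" using nz by simp
  moreover have "q (hstep d n e s w) = fst (hstep d n e s w) / snd (hstep d n e s w)"
    by (simp add: q_def)
  ultimately have "dskp_den (q d) (q n) (q e) (q s) (q w) \<noteq> 0"
    "dskp_den (q d) (q n) (q e) (q s) (q w) * q (hstep d n e s w) =
      (q d - q n) * (q s - q e) * q w - (q n - q w) * (q e - q d) * q s"
    using nz(6) by auto
  moreover have "q n \<noteq> q e" "q n \<noteq> q w" "q s \<noteq> q e" "q s \<noteq> q w"
    using ne nz by (auto simp: wedge)
  ultimately show ?thesis by (simp add: dskp_def)
qed

lemma hsol_solution:
  assumes "\<And>l f. nondegeneracy a l f \<noteq> 0"
  defines "X \<equiv> \<lambda>l f. fst (hsol a l f) / snd (hsol a l f)"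
  shows "dskp_solution X" and "layer X 0 = a"
proof -
  have nz: "fst (hsol a l f) \<noteq> 0" "snd (hsol a l f) \<noteq> 0" for l f
    using assms(1)[of l f] by (cases f; simp add: nondegeneracy_def)+
  have wedge: "wedge (hsol a l (x, y)) (hsol a l (x + 1, y + 1)) \<noteq> 0"
    "wedge (hsol a l (x, y)) (hsol a l (x - 1, y + 1)) \<noteq> 0" for l x y
    using assms(1)[of l "(x, y)"] by (simp_all add: nondegeneracy_def)
  have sym: "wedge v w \<noteq> 0 \<Longrightarrow> wedge w v \<noteq> 0" for v w
    by (auto simp: wedge_def)
  have "dskp (X l (x, y)) (X (Suc l) (x, y + 1)) (X (Suc l) (x + 1, y))
       (X (Suc l) (x, y - 1)) (X (Suc l) (x - 1, y)) (X (Suc (Suc l)) (x, y))" for l x y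
    unfolding X_def hsol.simps
  proof (rule dskp_hstep)
    show "snd (hstep (hsol a l (x, y)) (hsol a (Suc l) (x, y + 1)) (hsol a (Suc l) (x + 1, y))
        (hsol a (Suc l) (x, y - 1)) (hsol a (Suc l) (x - 1, y))) \<noteq> 0"
      using nz(2)[of "Suc (Suc l)" "(x, y)"] by simp
    show "wedge (hsol a (Suc l) (x, y + 1)) (hsol a (Suc l) (x + 1, y)) \<noteq> 0"
      using sym[OF wedge(2)[of "Suc l" "x + 1" y]] by simp
    show "wedge (hsol a (Suc l) (x, y + 1)) (hsol a (Suc l) (x - 1, y)) \<noteq> 0"
      using sym[OF wedge(1)[of "Suc l" "x - 1" y]] by simp
    show "wedge (hsol a (Suc l) (x, y - 1)) (hsol a (Suc l) (x + 1, y)) \<noteq> 0"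
      using wedge(1)[of "Suc l" x "y - 1"] by simp
    show "wedge (hsol a (Suc l) (x, y - 1)) (hsol a (Suc l) (x - 1, y)) \<noteq> 0"
      using wedge(2)[of "Suc l" x "y - 1"] by simp
  qed (rule nz)+
  moreover have "X l f \<noteq> 0" for l f using nz by (simp add: X_def)
  ultimately show "dskp_solution X" unfolding dskp_solution_def by blast
  show "layer X 0 = a" by (auto simp: layer_def X_def fun_eq_iff)
qed

text \<open>The half keeps the weights away from 0; dependence on \<open>x\<close> alone makes the
  solution constant in time.\<close>

definition base_weights :: "face \<Rightarrow> complex" where
  "base_weights = (\<lambda>(x, y). of_int x + 1 / 2)"

text \<open>The vectors at \<open>d\<close>, \<open>n\<close> and \<open>s\<close> represent the
  same point, so the first summand of \<open>hstep\<close> vanishes and the second is a multiple of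
  \<open>s\<close>. The multiple is nonzero because neighbouring columns differ by 1.\<close>

lemma hsol_base: "\<exists>c. c \<noteq> 0 \<and> hsol base_weights l (x, y) = (c * (of_int x + 1 / 2), c)"
proof (induction l arbitrary: x y rule: less_induct)
  case (less l)
  consider "l = 0 \<or> l = 1" | l' where "l = Suc (Suc l')"
    by (metis One_nat_def not0_implies_Suc)
  then show ?case
  proof cases
    case 1
    then show ?thesis by (auto simp: base_weights_def)
  next
    case 2
    let ?h = "hsol base_weights"
    obtain d where d: "d \<noteq> 0" "?h l' (x, y) = (d * (of_int x + 1 / 2), d)"
      using less.IH[of l' x y] 2 by auto
    obtain n where n: "n \<noteq> 0" "?h (Suc l') (x, y + 1) = (n * (of_int x + 1 / 2), n)"
      using less.IH[of "Suc l'" x "y + 1"] 2 by auto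
    obtain e where e: "e \<noteq> 0" "?h (Suc l') (x + 1, y) = (e * (of_int (x + 1) + 1 / 2), e)"
      using less.IH[of "Suc l'" "x + 1" y] 2 by auto
    obtain s where s: "s \<noteq> 0" "?h (Suc l') (x, y - 1) = (s * (of_int x + 1 / 2), s)"
      using less.IH[of "Suc l'" x "y - 1"] 2 by auto
    obtain w where w: "w \<noteq> 0" "?h (Suc l') (x - 1, y) = (w * (of_int (x - 1) + 1 / 2), w)"
      using less.IH[of "Suc l'" "x - 1" y] 2 by auto
    have "?h l (x, y) = (- (n * w * e * d * s) * (of_int x + 1 / 2), - (n * w * e * d * s))"
      unfolding 2 hsol.simps d(2) n(2) e(2) s(2) w(2) hstep_def wedge_def fst_conv snd_conv
      by (simp add: algebra_simps)
    then show ?thesis using d(1) n(1) e(1) s(1) w(1)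
      by (intro exI[of _ "- (n * w * e * d * s)"]) simp
  qed
qed

lemma nondegeneracy_base: "nondegeneracy base_weights l f \<noteq> 0"
proof -
  obtain x y where f: "f = (x, y)" by (cases f)
  have half: "of_int x + 1 / 2 \<noteq> (0 :: complex)" for x
  proof
    assume "of_int x + 1 / 2 = (0 :: complex)"
    then have "of_int (2 * x + 1) = (0 :: complex)" by (simp add: field_simps)
    then have "2 * x + 1 = 0" by (simp only: of_int_eq_0_iff)
    then show False by presburger
  qed
  obtain c where c: "c \<noteq> 0" "hsol base_weights l (x, y) = (c * (of_int x + 1 / 2), c)"
    using hsol_base by blast
  obtain c' where c': "c' \<noteq> 0"
    "hsol base_weights l (x + 1, y + 1) = (c' * (of_int (x + 1) + 1 / 2), c')"
    using hsol_base by blast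
  obtain c'' where c'': "c'' \<noteq> 0"
    "hsol base_weights l (x - 1, y + 1) = (c'' * (of_int (x - 1) + 1 / 2), c'')"
    using hsol_base by blast
  have "wedge (hsol base_weights l (x, y)) (hsol base_weights l (x + 1, y + 1)) = - (c * c')"
    "wedge (hsol base_weights l (x, y)) (hsol base_weights l (x - 1, y + 1)) = c * c''"
    unfolding c(2) c'(2) c''(2) by (simp_all add: wedge_def algebra_simps)
  then show ?thesis
    using half[of x] c(1) c'(1) c''(1) by (simp add: f nondegeneracy_def c(2))
qed

section \<open>Density of nondegenerate weights\<close>

definition polynomial_fun :: "(complex \<Rightarrow> complex) \<Rightarrow> bool" where
  "polynomial_fun g \<longleftrightarrow> (\<exists>q. \<forall>t. g t = poly q t)"

lemma polynomial_fun_intros: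
  "polynomial_fun (\<lambda>t. c)" "polynomial_fun (\<lambda>t. t)"
  "polynomial_fun g \<Longrightarrow> polynomial_fun h \<Longrightarrow> polynomial_fun (\<lambda>t. g t + h t)"
  "polynomial_fun g \<Longrightarrow> polynomial_fun h \<Longrightarrow> polynomial_fun (\<lambda>t. g t - h t)"
  "polynomial_fun g \<Longrightarrow> polynomial_fun h \<Longrightarrow> polynomial_fun (\<lambda>t. g t * h t)"
proof -
  show "polynomial_fun (\<lambda>t. c)" unfolding polynomial_fun_def by (rule exI[of _ "[:c:]"]) simp
  show "polynomial_fun (\<lambda>t. t)" unfolding polynomial_fun_def by (rule exI[of _ "[:0, 1:]"]) simp
  assume "polynomial_fun g" "polynomial_fun h"
  then obtain q r where qr: "\<And>t. g t = poly q t" "\<And>t. h t = poly r t"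
    unfolding polynomial_fun_def by blast
  show "polynomial_fun (\<lambda>t. g t + h t)" "polynomial_fun (\<lambda>t. g t - h t)" "polynomial_fun (\<lambda>t. g t * h t)"
    unfolding polynomial_fun_def qr by (metis poly_add, metis poly_diff, metis poly_mult)
qed

lemma polynomial_fun_hsol:
  assumes "\<And>f. polynomial_fun (\<lambda>t. a t f)"
  shows "polynomial_fun (\<lambda>t. fst (hsol (a t) l f)) \<and> polynomial_fun (\<lambda>t. snd (hsol (a t) l f))"
proof (induction l arbitrary: f rule: less_induct)
  case (less l)
  consider "l = 0 \<or> l = 1" | l' where "l = Suc (Suc l')"
    by (metis One_nat_def not0_implies_Suc)
  then show ?case
  proof cases
    case 1
    then show ?thesis using assms[of f] by (auto intro: polynomial_fun_intros)
  next
    case 2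
    obtain x y where f: "f = (x, y)" by (cases f)
    show ?thesis
      unfolding 2 f hsol.simps hstep_def wedge_def fst_conv snd_conv
      by (intro conjI polynomial_fun_intros; use less.IH[of l'] less.IH[of "Suc l'"] 2 in simp)
  qed
qed

text \<open>On the complex line from \<open>b\<close> at \<open>t = 0\<close> to
  \<open>base_weights\<close> at \<open>t = 1\<close>, each condition is a polynomial in
  \<open>t\<close> that is nonzero at 1, so it fails at finitely many points. There are countably
  many conditions, and a ball is uncountable.\<close>

lemma ex_nondegenerate:
  assumes "\<epsilon> > 0"
  shows "\<exists>t :: complex. norm t < \<epsilon> \<and>
    (\<forall>l f. nondegeneracy (\<lambda>f. (1 - t) * b f + t * base_weights f) l f \<noteq> 0)"
proof -
  let ?a = "\<lambda>t f. (1 - t) * b f + t * base_weights f"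
  define bad where "bad l f = {t. nondegeneracy (?a t) l f = 0}" for l f
  have a: "polynomial_fun (\<lambda>t. ?a t f)" for f
    by (intro polynomial_fun_intros)
  have fin: "finite (bad l f)" for l f
  proof -
    obtain x y where f: "f = (x, y)" by (cases f)
    have "polynomial_fun (\<lambda>t. nondegeneracy (?a t) l f)"
      unfolding f nondegeneracy_def wedge_def prod.case
      by (intro polynomial_fun_intros polynomial_fun_hsol[OF a, THEN conjunct1]
          polynomial_fun_hsol[OF a, THEN conjunct2])
    then obtain q where q: "\<And>t. nondegeneracy (?a t) l f = poly q t"
      unfolding polynomial_fun_def by blast
    have "poly q 1 \<noteq> 0"
      using q[of 1] nondegeneracy_base[of l f] by simp
    then have "q \<noteq> 0" by auto
    then show ?thesis unfolding bad_def q by (rule poly_roots_finite)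
  qed
  have "countable (\<Union>l. \<Union>f. bad l f)"
    by (rule countable_UN[OF countableI_type], rule countable_UN[OF countableI_type],
        rule countable_finite, rule fin)
  moreover have "uncountable (ball 0 \<epsilon> :: complex set)"
    using assms by (rule uncountable_ball)
  ultimately have "\<not> ball 0 \<epsilon> \<subseteq> (\<Union>l. \<Union>f. bad l f)"
    using countable_subset by blast
  then obtain t where "t \<in> ball 0 \<epsilon>" "t \<notin> (\<Union>l. \<Union>f. bad l f)" by blast
  then show ?thesis unfolding bad_def by (intro exI[of _ t]) auto
qed

section \<open>Limits in the sphere\<close>

fun lift :: "sphere \<Rightarrow> complex \<times> complex" where
  "lift (Some z) = (z, 1)"
| "lift None = (1, 0)"

text \<open>Convergence in the projective line. The factors \<open>c n\<close> are free because the
  vectors of \<open>hsol\<close> are not normalised.\<close>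

definition projective_limit :: "(nat \<Rightarrow> complex \<times> complex) \<Rightarrow> sphere \<Rightarrow> bool" where
  "projective_limit v y \<longleftrightarrow> (\<exists>c. (\<forall>n. c n \<noteq> 0) \<and>
     (\<lambda>n. c n * fst (v n)) \<longlonglongrightarrow> fst (lift y) \<and> (\<lambda>n. c n * snd (v n)) \<longlonglongrightarrow> snd (lift y))"

lemma hstep_scale:
  "fst (hstep (\<delta> * fst d, \<delta> * snd d) (\<nu> * fst n, \<nu> * snd n) (\<eta> * fst e, \<eta> * snd e)
     (\<sigma> * fst s, \<sigma> * snd s) (\<omega> * fst w, \<omega> * snd w)) = \<delta> * \<nu> * \<eta> * \<sigma> * \<omega> * fst (hstep d n e s w)"
  "snd (hstep (\<delta> * fst d, \<delta> * snd d) (\<nu> * fst n, \<nu> * snd n) (\<eta> * fst e, \<eta> * snd e)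
     (\<sigma> * fst s, \<sigma> * snd s) (\<omega> * fst w, \<omega> * snd w)) = \<delta> * \<nu> * \<eta> * \<sigma> * \<omega> * snd (hstep d n e s w)"
  by (simp_all add: hstep_def wedge_def algebra_simps)

text \<open>\<open>hstep\<close> is multilinear, so the scaling factors come out as a product. A
  nonzero \<open>\<kappa>\<close> means that the step at the limit still represents a point;
  dividing by it normalises the result.\<close>

lemma projective_limit_hstep:
  assumes "projective_limit d D" "projective_limit n N" "projective_limit e E"
    "projective_limit s S" "projective_limit w W"
    and \<kappa>: "\<kappa> \<noteq> 0" "hstep (lift D) (lift N) (lift E) (lift S) (lift W) = (\<kappa> * fst (lift U), \<kappa> * snd (lift U))"
  shows "projective_limit (\<lambda>m. hstep (d m) (n m) (e m) (s m) (w m)) U"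
proof -
  obtain \<delta> where \<delta>: "\<And>m. \<delta> m \<noteq> 0" "(\<lambda>m. \<delta> m * fst (d m)) \<longlonglongrightarrow> fst (lift D)" "(\<lambda>m. \<delta> m * snd (d m)) \<longlonglongrightarrow> snd (lift D)"
    using assms(1) by (auto simp: projective_limit_def)
  obtain \<nu> where \<nu>: "\<And>m. \<nu> m \<noteq> 0" "(\<lambda>m. \<nu> m * fst (n m)) \<longlonglongrightarrow> fst (lift N)" "(\<lambda>m. \<nu> m * snd (n m)) \<longlonglongrightarrow> snd (lift N)"
    using assms(2) by (auto simp: projective_limit_def)
  obtain \<eta> where \<eta>: "\<And>m. \<eta> m \<noteq> 0" "(\<lambda>m. \<eta> m * fst (e m)) \<longlonglongrightarrow> fst (lift E)" "(\<lambda>m. \<eta> m * snd (e m)) \<longlonglongrightarrow> snd (lift E)"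
    using assms(3) by (auto simp: projective_limit_def)
  obtain \<sigma> where \<sigma>: "\<And>m. \<sigma> m \<noteq> 0" "(\<lambda>m. \<sigma> m * fst (s m)) \<longlonglongrightarrow> fst (lift S)" "(\<lambda>m. \<sigma> m * snd (s m)) \<longlonglongrightarrow> snd (lift S)"
    using assms(4) by (auto simp: projective_limit_def)
  obtain \<omega> where \<omega>: "\<And>m. \<omega> m \<noteq> 0" "(\<lambda>m. \<omega> m * fst (w m)) \<longlonglongrightarrow> fst (lift W)" "(\<lambda>m. \<omega> m * snd (w m)) \<longlonglongrightarrow> snd (lift W)"
    using assms(5) by (auto simp: projective_limit_def)
  let ?h = "\<lambda>m. hstep (d m) (n m) (e m) (s m) (w m)"
  let ?g = "\<lambda>m. hstep (\<delta> m * fst (d m), \<delta> m * snd (d m)) (\<nu> m * fst (n m), \<nu> m * snd (n m))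
    (\<eta> m * fst (e m), \<eta> m * snd (e m)) (\<sigma> m * fst (s m), \<sigma> m * snd (s m)) (\<omega> m * fst (w m), \<omega> m * snd (w m))"
  let ?c = "\<lambda>m. \<delta> m * \<nu> m * \<eta> m * \<sigma> m * \<omega> m"
  let ?L = "hstep (lift D) (lift N) (lift E) (lift S) (lift W)"
  have "(\<lambda>m. fst (?g m)) \<longlonglongrightarrow> fst ?L" "(\<lambda>m. snd (?g m)) \<longlonglongrightarrow> snd ?L"
    unfolding hstep_def wedge_def fst_conv snd_conv by (intro tendsto_intros \<delta> \<nu> \<eta> \<sigma> \<omega>)+
  then have "(\<lambda>m. fst (?g m) / \<kappa>) \<longlonglongrightarrow> fst ?L / \<kappa>" "(\<lambda>m. snd (?g m) / \<kappa>) \<longlonglongrightarrow> snd ?L / \<kappa>"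
    using \<kappa>(1) by (auto intro: tendsto_divide)
  then have "(\<lambda>m. (?c m / \<kappa>) * fst (?h m)) \<longlonglongrightarrow> fst (lift U)" "(\<lambda>m. (?c m / \<kappa>) * snd (?h m)) \<longlonglongrightarrow> snd (lift U)"
    using \<kappa>(1) unfolding hstep_scale \<kappa>(2) fst_conv snd_conv by simp_all
  moreover have "?c m / \<kappa> \<noteq> 0" for m using \<delta>(1) \<nu>(1) \<eta>(1) \<sigma>(1) \<omega>(1) \<kappa>(1) by simp
  ultimately show ?thesis unfolding projective_limit_def by (intro exI[of _ "\<lambda>m. ?c m / \<kappa>"]) blast
qed

text \<open>The P-net equation is the dSKP equation in which the two neighbours in one direction coincide.\<close>

lemma P_net_hstep:
  fixes i j :: int
  assumes "P_net p"
  defines "c \<equiv> p (i, j)" and "e \<equiv> p (i + 1, j)" and "w \<equiv> p (i - 1, j)" and "d \<equiv> p (i, j - 1)" and "u \<equiv> p (i, j + 1)"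
  shows "\<exists>\<kappa>. \<kappa> \<noteq> 0 \<and> hstep (lift d) (lift c) (lift e) (lift c) (lift w) = (\<kappa> * fst (lift u), \<kappa> * snd (lift u))"
proof -
  have ne: "e \<noteq> c" "u \<noteq> c" "w \<noteq> c" "d \<noteq> c"
    and eq: "recip_diff c e - recip_diff c u + recip_diff c w - recip_diff c d = 0"
    using assms unfolding P_net_def by blast+
  show ?thesis
  proof (cases c)
    case None
    then obtain e' u' w' d' where x: "e = Some e'" "u = Some u'" "w = Some w'" "d = Some d'"
      using ne by auto
    \<comment> \<open>All wedges with the lift of the infinite \<open>c\<close> are plus or minus 1,
      which reduces \<open>hstep\<close> to this affine expression with factor -1.\<close>
    then have "u' = e' + w' - d'" using eq None by (simp add: algebra_simps)
    then show ?thesis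
      by (intro exI[of _ "-1"]) (simp add: None x hstep_def wedge_def algebra_simps)
  next
    case (Some z)
    \<comment> \<open>With \<open>r = 1 / (x - z)\<close> one has
      \<open>x = (1 + z * r) / r\<close>, which covers infinite \<open>x\<close> as
      \<open>r = 0\<close>. In the coordinate \<open>r\<close> the P-net equation is linear.\<close>
    have coord: "\<exists>k. k \<noteq> 0 \<and> lift x = (k * (1 + z * recip_diff c x), k * recip_diff c x)" if "x \<noteq> c" for x
    proof (cases x)
      case None
      then show ?thesis using Some by (intro exI[of _ 1]) simp
    next
      case (Some y)
      then have "y - z \<noteq> 0" using that \<open>c = Some z\<close> by auto
      then show ?thesis using Some \<open>c = Some z\<close> by (intro exI[of _ "y - z"]) (simp add: field_simps)
    qed
    obtain ke ku kw kd where k: "ke \<noteq> 0" "ku \<noteq> 0" "kw \<noteq> 0" "kd \<noteq> 0"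
      and l: "lift e = (ke * (1 + z * recip_diff c e), ke * recip_diff c e)"
        "lift u = (ku * (1 + z * recip_diff c u), ku * recip_diff c u)"
        "lift w = (kw * (1 + z * recip_diff c w), kw * recip_diff c w)"
        "lift d = (kd * (1 + z * recip_diff c d), kd * recip_diff c d)"
      using coord[OF ne(1)] coord[OF ne(2)] coord[OF ne(3)] coord[OF ne(4)] by blast
    have c: "lift c = (z, 1)" using Some by simp
    have u: "recip_diff c u = recip_diff c e + recip_diff c w - recip_diff c d"
      using eq by (simp add: algebra_simps)
    \<comment> \<open>The wedge of \<open>lift c\<close> with \<open>k * (1 + z * r, r)\<close> is
      \<open>- k\<close>, so only the wedge of \<open>e\<close> and \<open>d\<close> involves the
      values of \<open>r\<close>.\<close>
    have "hstep (lift d) (lift c) (lift e) (lift c) (lift w) =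
        (- (kd * ke * kw) * (1 + z * recip_diff c u), - (kd * ke * kw) * recip_diff c u)"
      unfolding l(1,3,4) c u by (simp add: hstep_def wedge_def algebra_simps)
    then show ?thesis
      using k by (intro exI[of _ "- (kd * ke * kw) / ku"]) (simp add: l(2))
  qed
qed

text \<open>The second coordinate of the P-net serves as time, and both \<open>n\<close> and
  \<open>s\<close> are \<open>p (x, l + 1)\<close>. The parity condition makes the weight at
  \<open>(x, y)\<close> equal to \<open>p (x, l)\<close> for \<open>l\<close> = 0 and 1.\<close>

lemma projective_limit_hsol:
  assumes p: "P_net p" and a: "\<And>f. projective_limit (\<lambda>n. (a n f, 1)) (P_net_weights p f)"
  shows "even (x + y + int l) \<Longrightarrow> projective_limit (\<lambda>n. hsol (a n) l (x, y)) (p (x, int l))"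
proof (induction l arbitrary: x y rule: less_induct)
  case (less l)
  consider "l = 0 \<or> l = 1" | l' where "l = Suc (Suc l')"
    by (metis One_nat_def not0_implies_Suc)
  then show ?case
  proof cases
    case 1
    then have "(x + y) mod 2 = int l" using less.prems by auto
    then show ?thesis using a[of "(x, y)"] 1 by (auto simp: P_net_weights_def)
  next
    case 2
    have lim: "projective_limit (\<lambda>n. hsol (a n) l' (x, y)) (p (x, int l'))"
      "projective_limit (\<lambda>n. hsol (a n) (Suc l') (x, y + 1)) (p (x, int (Suc l')))"
      "projective_limit (\<lambda>n. hsol (a n) (Suc l') (x + 1, y)) (p (x + 1, int (Suc l')))"
      "projective_limit (\<lambda>n. hsol (a n) (Suc l') (x, y - 1)) (p (x, int (Suc l')))"
      "projective_limit (\<lambda>n. hsol (a n) (Suc l') (x - 1, y)) (p (x - 1, int (Suc l')))"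
      by (rule less.IH; use less.prems 2 in auto)+
    obtain \<kappa> where "\<kappa> \<noteq> 0" "hstep (lift (p (x, int l'))) (lift (p (x, int (Suc l'))))
        (lift (p (x + 1, int (Suc l')))) (lift (p (x, int (Suc l')))) (lift (p (x - 1, int (Suc l')))) =
        (\<kappa> * fst (lift (p (x, int l))), \<kappa> * snd (lift (p (x, int l))))"
      using P_net_hstep[OF p, of x "int (Suc l')"] 2 by (auto simp: add.commute)
    from projective_limit_hstep[OF lim this] show ?thesis
      unfolding 2 hsol.simps by simp
  qed
qed

text \<open>At an infinite limit the scaled numerators tend to 1 and the scaled denominators to 0
  without vanishing, so the quotients leave every compact set.\<close>

lemma limitin_projective:
  assumes "projective_limit v y" and nz: "\<And>n. snd (v n) \<noteq> 0"
  shows "limitin sphere_top (\<lambda>n. Some (fst (v n) / snd (v n))) y sequentially"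
proof -
  obtain c where c: "\<And>n. c n \<noteq> 0" "(\<lambda>n. c n * fst (v n)) \<longlonglongrightarrow> fst (lift y)" "(\<lambda>n. c n * snd (v n)) \<longlonglongrightarrow> snd (lift y)"
    using assms(1) by (auto simp: projective_limit_def)
  have quot: "fst (v n) / snd (v n) = (c n * fst (v n)) / (c n * snd (v n))" for n
    using c(1) by simp
  show ?thesis
  proof (cases y)
    case (Some z)
    then have "(\<lambda>n. fst (v n) / snd (v n)) \<longlonglongrightarrow> z / 1"
      unfolding quot using c by (intro tendsto_divide) auto
    then show ?thesis
      unfolding sphere_top_def Some
      using continuous_map_limit[OF continuous_map_Some, of euclidean] by (simp add: o_def)
  next
    case None
    have "filterlim (\<lambda>n. (c n * fst (v n)) / (c n * snd (v n))) at_infinity sequentially"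
      unfolding divide_inverse
    proof (rule tendsto_mult_filterlim_at_infinity)
      show "(\<lambda>n. c n * fst (v n)) \<longlonglongrightarrow> 1" using c(2) None by simp
      have "filterlim (\<lambda>n. c n * snd (v n)) (at 0) sequentially"
        using c(1,3) None nz by (simp add: filterlim_at)
      then show "filterlim (\<lambda>n. inverse (c n * snd (v n))) at_infinity sequentially"
        by (rule filterlim_compose[OF filterlim_inverse_at_infinity])
    qed simp
    then have inf: "filterlim (\<lambda>n. fst (v n) / snd (v n)) at_infinity sequentially"
      unfolding quot .
    show ?thesis
      unfolding limitin_def None
    proof (intro conjI allI impI)
      show "None \<in> topspace sphere_top" by (simp add: sphere_top_def)
      fix U assume "openin sphere_top U \<and> None \<in> U"
      then obtain C where C: "compact C" "U = insert None (Some ` (- C))"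
        by (auto simp: sphere_top_def openin_Alexandroff_compactification Compl_eq_Diff_UNIV)
      then obtain B where B: "\<forall>z \<in> C. norm z \<le> B" using compact_imp_bounded bounded_iff by metis
      \<comment> \<open>The bound \<open>B\<close> may be negative if \<open>C\<close> is empty; the
        maximum makes the threshold positive.\<close>
      have "eventually (\<lambda>n. max B 0 + 1 \<le> norm (fst (v n) / snd (v n))) sequentially"
        using inf unfolding filterlim_at_infinity[OF order_refl] by auto
      then show "eventually (\<lambda>n. Some (fst (v n) / snd (v n)) \<in> U) sequentially"
        by (rule eventually_mono) (use B in \<open>force simp: C(2)\<close>)
    qed
  qed
qed

text \<open>
  Infinite weights are approached along \<open>n\<close>, and the perturbation towards a nondegenerate solution
  is \<open>O(1 / n\<^sup>2)\<close> so that it stays negligible there.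
\<close>

lemma ex_nondegenerate_sequence:
  fixes \<alpha> :: "face \<Rightarrow> sphere"
  shows "\<exists>b. (\<forall>n l f. nondegeneracy (b n) l f \<noteq> 0) \<and> (\<forall>f. projective_limit (\<lambda>n. (b n f, 1)) (\<alpha> f))"
proof -
  define \<beta> where "\<beta> n f = (case \<alpha> f of Some z \<Rightarrow> z | None \<Rightarrow> of_nat (Suc n))" for n :: nat and f
  have "\<exists>t :: complex. norm t < inverse (real (Suc n)) ^ 2 \<and>
      (\<forall>l f. nondegeneracy (\<lambda>f. (1 - t) * \<beta> n f + t * base_weights f) l f \<noteq> 0)" for n
    by (rule ex_nondegenerate) simp
  then obtain t :: "nat \<Rightarrow> complex" where t: "\<And>n. norm (t n) < inverse (real (Suc n)) ^ 2"
      "\<And>n l f. nondegeneracy (\<lambda>f. (1 - t n) * \<beta> n f + t n * base_weights f) l f \<noteq> 0"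
    by metis
  define b where "b n f = (1 - t n) * \<beta> n f + t n * base_weights f" for n f
  have inv: "(\<lambda>n. inverse (real (Suc n))) \<longlonglongrightarrow> 0"
    by (rule LIMSEQ_inverse_real_of_nat)
  have "(\<lambda>n. inverse (real (Suc n)) ^ 2) \<longlonglongrightarrow> 0"
    using tendsto_power[OF inv, of 2] by simp
  moreover have "eventually (\<lambda>n. norm (t n) \<le> inverse (real (Suc n)) ^ 2) sequentially"
    by (intro always_eventually allI less_imp_le t(1))
  ultimately have t0: "t \<longlonglongrightarrow> 0"
    by (rule Lim_null_comparison[rotated])
  have "projective_limit (\<lambda>n. (b n f, 1)) (\<alpha> f)" for f
  proof (cases "\<alpha> f")
    case (Some z)
    have "b n f = (1 - t n) * z + t n * base_weights f" for n by (simp add: b_def \<beta>_def Some)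
    moreover have "(\<lambda>n. (1 - t n) * z + t n * base_weights f) \<longlonglongrightarrow> (1 - 0) * z + 0 * base_weights f"
      by (intro tendsto_intros t0)
    ultimately show ?thesis unfolding projective_limit_def
      by (intro exI[of _ "\<lambda>_. 1"]) (simp add: Some)
  next
    case None
    \<comment> \<open>Scaling by \<open>1 / (n + 1)\<close> turns the approximating weight
      \<open>n + 1\<close> into 1 and the second coordinate into a null sequence, with limit (1,
      0).\<close>
    let ?c = "\<lambda>n. inverse (of_nat (Suc n)) :: complex"
    have c: "?c \<longlonglongrightarrow> 0" by (rule LIMSEQ_Suc[OF lim_inverse_n])
    have "?c n * b n f = (1 - t n) + t n * (?c n * base_weights f)" for n
      by (simp add: b_def \<beta>_def None field_simps del: of_nat_Suc)
    moreover have "(\<lambda>n. (1 - t n) + t n * (?c n * base_weights f)) \<longlonglongrightarrow> (1 - 0) + 0 * (0 * base_weights f)"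
      by (intro tendsto_intros t0 c)
    ultimately show ?thesis unfolding projective_limit_def
      using c by (intro exI[of _ ?c]) (simp add: None del: of_nat_Suc)
  qed
  then show ?thesis using t(2) by (intro exI[of _ b]) (auto simp: b_def[abs_def])
qed

lemma filterlim_weights_near:
  assumes "\<And>f. f \<in> F \<Longrightarrow> limitin sphere_top (\<lambda>n. Some (b n f)) (\<alpha> f) G"
  shows "filterlim b (weights_near F \<alpha>) G"
  unfolding weights_near_def filterlim_INF
proof
  fix f assume "f \<in> F"
  then have "filterlim (\<lambda>n. Some (b n f)) (nhdsin sphere_top (\<alpha> f)) G"
    using assms[of f] by (auto simp: limitin_def filterlim_iff eventually_nhdsin elim!: eventually_mono)
  then show "filterlim b (filtercomap (\<lambda>b. Some (b f)) (nhdsin sphere_top (\<alpha> f))) G"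
    by (simp add: filterlim_filtercomap_iff o_def)
qed

theorem theorem1p2:
  fixes p :: "int \<times> int \<Rightarrow> complex option"
    and i j :: int and k :: nat
    and \<phi> :: "arc \<Rightarrow> int"
  assumes "P_net p"
    and "k \<ge> 1"
    and "(i + j) mod 2 = int k mod 2"
    and "kasteleyn (k - 1) (i, j) \<phi>"
    and "Y_defined (k - 1) (i, j) \<phi> (P_net_weights p)"
  shows "p (i, int k) = Y_value (k - 1) (i, j) \<phi> (P_net_weights p)"
proof -
  let ?K = "k - 1" and ?F = "all_faces (k - 1) (i, j)"
  obtain b where b: "\<And>n l f. nondegeneracy (b n) l f \<noteq> 0"
      "\<And>f. projective_limit (\<lambda>n. (b n f, 1)) (P_net_weights p f)"
    using ex_nondegenerate_sequence[of "P_net_weights p"] by blast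
  have ev: "even (i + j + int k)" using assms(3) by presburger
  \<comment> \<open>The parity condition of \<open>ratio_Y_solution\<close> for
    \<open>l = 0\<close>; size \<open>k - 1\<close> then yields the solution at time
    \<open>Suc (k - 1) = k\<close>.\<close>
  then have odd: "odd (i + j + int 0 + int ?K)" using assms(2) by (auto simp: of_nat_diff)
  have snd: "snd (hsol (b n) l f) \<noteq> 0" and fst: "b n f \<noteq> 0" for n l f
    using b(1)[of n l f] b(1)[of n 0 f] by (cases f; simp add: nondegeneracy_def)+
  have Y: "dimer_Z ?K (i, j) (b n) \<phi> \<noteq> 0 \<and>
      ratio_Y ?K (i, j) (b n) \<phi> = fst (hsol (b n) k (i, j)) / snd (hsol (b n) k (i, j))" for n
    using ratio_Y_solution[OF hsol_solution(1)[OF b(1)] assms(4) odd, of n] assms(2)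
    unfolding hsol_solution(2)[OF b(1)] by simp
  \<comment> \<open>The sequence \<open>b\<close> stays regular and tends to the given weights, so
    every value of \<open>Y\<close> is also the limit along \<open>b\<close>.\<close>
  have "filterlim b (inf (weights_near ?F (P_net_weights p)) (principal (regular_weights ?K (i, j) \<phi>))) sequentially"
    unfolding filterlim_inf filterlim_principal
  proof
    show "filterlim b (weights_near ?F (P_net_weights p)) sequentially"
      using limitin_projective[OF b(2)] by (intro filterlim_weights_near) simp
    show "eventually (\<lambda>n. b n \<in> regular_weights ?K (i, j) \<phi>) sequentially"
      using Y fst by (simp add: regular_weights_def)
  qed
  note G = this
  have lim: "limitin sphere_top (\<lambda>n. Some (ratio_Y ?K (i, j) (b n) \<phi>)) (p (i, int k)) sequentially"
    using limitin_projective[OF projective_limit_hsol[OF assms(1) b(2) ev] snd] Y by simp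
  \<comment> \<open>The limit along \<open>b\<close> is \<open>p (i, k)\<close> and the sphere is
    Hausdorff; this determines the value picked by \<open>THE\<close>.\<close>
  have unique: "y = p (i, int k)" if "Y_has_value ?K (i, j) \<phi> (P_net_weights p) y" for y
  proof -
    have "limitin sphere_top (\<lambda>n. Some (ratio_Y ?K (i, j) (b n) \<phi>)) y sequentially"
      using that G unfolding Y_has_value_def limitin_def filterlim_iff by blast
    then show ?thesis
      using lim by (rule limitin_Hausdorff_unique) (simp_all add: Hausdorff_sphere_top)
  qed
  then show ?thesis
    using assms(5) unfolding Y_defined_def Y_value_def by (metis the_equality)
qed

end
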